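(* Vopěnka's Principle holds if and only if for every logic $\mathcal L$, $\mathrm{ULST}(\mathcal L)$ exists.
   Context: A logic $\mathcal L$ assigns to each (set-sized) language $\tau$ a set $\mathcal L(\tau)$ of sentences together with a satisfaction relation $\models_{\mathcal L}$ between $\tau$-structures and $\mathcal L(\tau)$-sentences, respecting reducts, isomorphisms and renamings of languages, and having an occurrence number (a cardinal $\mu$ such that every sentence of $\mathcal L(\tau)$ lies in $\mathcal L(\bar\tau)$ for some $\bar\tau\subseteq\tau$ with $|\bar\tau|<\mu$). $\mathrm{ULST}(\mathcal L)$, if it exists, is the least cardinal $\delta$ such that for every language $\tau$, every $\mathcal L(\tau)$-sentence $\varphi$, every $\tau$-structure $M\models_{\mathcal L}\varphi$ with $|M|=\gamma\ge\delta$, and every cardinal $\bar\gamma>\gamma$, there is a $\tau$-structure $\bar M$ of size at least $\bar\gamma$ with $\bar M\models_{\mathcal L}\varphi$ and $M$ a substructure of $\bar M$. *)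

theory Defs
  imports Main "HOL-Library.Equipollence"
begin

section \<open>The universe of sets\<close>

text \<open>
  A type of class \<open>zfc\<close> is a universe of sets, given by its membership relation
  \<open>x \<in> elts y\<close>. Proper classes are predicates, sets and functions of the logic over such a type;
  accordingly replacement (which yields separation) ranges over all functions. The axiom of choice
  is not listed because it follows from replacement and Hilbert choice. Foundation is stated as
  \<open>\<in>\<close>-induction.
\<close>

class zfc =
  fixes elts :: "'a \<Rightarrow> 'a set"
  assumes extensionality: "elts x = elts y \<Longrightarrow> x = y"
    and foundation: "wf {(x, y). x \<in> elts y}"
    and pairing: "\<exists>z. elts z = {x, y}"
    and union: "\<exists>z. elts z = (\<Union>y\<in>elts x. elts y)"
    and powerset: "\<exists>z. elts z = {y. elts y \<subseteq> elts x}"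
    and replacement: "\<exists>z. elts z = f ` elts x"
    and infinity: "\<exists>z. (\<exists>e\<in>elts z. elts e = {}) \<and>
                       (\<forall>x\<in>elts z. \<exists>y\<in>elts z. elts y = insert x (elts x))"

text \<open>
  A collection of objects of any type is set-sized if it injects into a set of the universe. For
  collections of sets this is the same, by replacement, as being of the form \<open>elts x\<close>.
\<close>

definition small :: "'v::zfc itself \<Rightarrow> 'b set \<Rightarrow> bool" where
  "small T A \<longleftrightarrow> (\<exists>x::'v. A \<lesssim> elts x)"

definition transitive_set :: "'v::zfc \<Rightarrow> bool" where
  "transitive_set x \<longleftrightarrow> (\<forall>y\<in>elts x. elts y \<subseteq> elts x)"

definition ordinal :: "'v::zfc \<Rightarrow> bool" where
  "ordinal \<alpha> \<longleftrightarrow> transitive_set \<alpha> \<and> (\<forall>\<beta>\<in>elts \<alpha>. transitive_set \<beta>)"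

text \<open>Cardinals are initial ordinals, so that \<open>\<kappa> < \<lambda>\<close> is \<open>\<kappa> \<in> elts \<lambda>\<close> and \<open>\<kappa> \<le> \<lambda>\<close> is
  \<open>elts \<kappa> \<subseteq> elts \<lambda>\<close>.\<close>

definition cardinal :: "'v::zfc \<Rightarrow> bool" where
  "cardinal \<kappa> \<longleftrightarrow> ordinal \<kappa> \<and> (\<forall>\<alpha>\<in>elts \<kappa>. \<not> elts \<alpha> \<approx> elts \<kappa>)"


section \<open>Languages and structures\<close>

text \<open>Symbols are finitary and carry their arity; constants are function symbols of arity 0.\<close>

datatype 'v symbol = is_Rel: RelSym (arity: nat) 'v | is_Fun: FunSym (arity: nat) 'v

type_synonym 'v language = "'v symbol set"

definition language :: "'v::zfc language \<Rightarrow> bool" where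
  "language \<tau> \<longleftrightarrow> small TYPE('v) \<tau>"

record 'v struct =
  lang :: "'v language"
  univ :: "'v set"
  rel_of :: "'v symbol \<Rightarrow> 'v list set"
  fun_of :: "'v symbol \<Rightarrow> 'v list \<Rightarrow> 'v"

definition tuples :: "'v set \<Rightarrow> nat \<Rightarrow> 'v list set" where
  "tuples A n = {xs. length xs = n \<and> set xs \<subseteq> A}"

text \<open>
  The interpretations take default values outside the language and outside the universe of the
  structure. Hence two structures are equal iff they agree on language, universe and
  interpretation of the symbols of the language.
\<close>

definition is_struct :: "'v::zfc struct \<Rightarrow> bool" where
  "is_struct M \<longleftrightarrow>
     language (lang M) \<and> small TYPE('v) (univ M) \<and> univ M \<noteq> {} \<and>
     (\<forall>s. if s \<in> lang M \<and> is_Rel s then rel_of M s \<subseteq> tuples (univ M) (arity s)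
          else rel_of M s = {}) \<and>
     (\<forall>s xs. if s \<in> lang M \<and> is_Fun s \<and> xs \<in> tuples (univ M) (arity s)
             then fun_of M s xs \<in> univ M
             else fun_of M s xs = undefined)"

definition is_structure_of :: "'v::zfc language \<Rightarrow> 'v struct \<Rightarrow> bool" where
  "is_structure_of \<tau> M \<longleftrightarrow> is_struct M \<and> lang M = \<tau>"

definition substructure :: "'v struct \<Rightarrow> 'v struct \<Rightarrow> bool" where
  "substructure M N \<longleftrightarrow>
     lang M = lang N \<and> univ M \<subseteq> univ N \<and>
     (\<forall>s\<in>lang M. is_Rel s \<longrightarrow> rel_of M s = rel_of N s \<inter> tuples (univ M) (arity s)) \<and>
     (\<forall>s\<in>lang M. is_Fun s \<longrightarrow>
        (\<forall>xs\<in>tuples (univ M) (arity s). fun_of M s xs = fun_of N s xs))"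

definition isomorphic :: "'v struct \<Rightarrow> 'v struct \<Rightarrow> bool" where
  "isomorphic M N \<longleftrightarrow>
     lang M = lang N \<and>
     (\<exists>h. bij_betw h (univ M) (univ N) \<and>
        (\<forall>s\<in>lang M. is_Rel s \<longrightarrow>
           (\<forall>xs\<in>tuples (univ M) (arity s). xs \<in> rel_of M s \<longleftrightarrow> map h xs \<in> rel_of N s)) \<and>
        (\<forall>s\<in>lang M. is_Fun s \<longrightarrow>
           (\<forall>xs\<in>tuples (univ M) (arity s). h (fun_of M s xs) = fun_of N s (map h xs))))"

definition reduct :: "'v language \<Rightarrow> 'v struct \<Rightarrow> 'v struct" where
  "reduct \<tau> M =
     \<lparr>lang = \<tau>, univ = univ M,
      rel_of = (\<lambda>s. if s \<in> \<tau> then rel_of M s else {}),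
      fun_of = (\<lambda>s xs. if s \<in> \<tau> then fun_of M s xs else undefined)\<rparr>"

definition renaming :: "('v symbol \<Rightarrow> 'v symbol) \<Rightarrow> 'v language \<Rightarrow> 'v language \<Rightarrow> bool" where
  "renaming f \<tau> \<sigma> \<longleftrightarrow>
     bij_betw f \<tau> \<sigma> \<and> (\<forall>s\<in>\<tau>. (is_Rel (f s) \<longleftrightarrow> is_Rel s) \<and> arity (f s) = arity s)"

definition rename :: "('v symbol \<Rightarrow> 'v symbol) \<Rightarrow> 'v struct \<Rightarrow> 'v struct" where
  "rename f M =
     \<lparr>lang = f ` lang M, univ = univ M,
      rel_of = (\<lambda>s. if s \<in> f ` lang M then rel_of M (inv_into (lang M) f s) else {}),
      fun_of = (\<lambda>s xs. if s \<in> f ` lang M then fun_of M (inv_into (lang M) f s) xs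
                       else undefined)\<rparr>"


section \<open>First-order logic and Vopenka's Principle\<close>

datatype 'v tm = Var nat | App "'v symbol" "'v tm list"

datatype 'v fm =
    Eq "'v tm" "'v tm"
  | Atom "'v symbol" "'v tm list"
  | Neg "'v fm"
  | Conj "'v fm" "'v fm"
  | Exi nat "'v fm"

fun wf_tm :: "'v language \<Rightarrow> 'v tm \<Rightarrow> bool" where
  "wf_tm \<tau> (Var n) \<longleftrightarrow> True"
| "wf_tm \<tau> (App s ts) \<longleftrightarrow>
     s \<in> \<tau> \<and> is_Fun s \<and> length ts = arity s \<and> (\<forall>t\<in>set ts. wf_tm \<tau> t)"

fun wf_fm :: "'v language \<Rightarrow> 'v fm \<Rightarrow> bool" where
  "wf_fm \<tau> (Eq t u) \<longleftrightarrow> wf_tm \<tau> t \<and> wf_tm \<tau> u"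
| "wf_fm \<tau> (Atom s ts) \<longleftrightarrow>
     s \<in> \<tau> \<and> is_Rel s \<and> length ts = arity s \<and> (\<forall>t\<in>set ts. wf_tm \<tau> t)"
| "wf_fm \<tau> (Neg p) \<longleftrightarrow> wf_fm \<tau> p"
| "wf_fm \<tau> (Conj p q) \<longleftrightarrow> wf_fm \<tau> p \<and> wf_fm \<tau> q"
| "wf_fm \<tau> (Exi n p) \<longleftrightarrow> wf_fm \<tau> p"

fun tm_val :: "'v struct \<Rightarrow> (nat \<Rightarrow> 'v) \<Rightarrow> 'v tm \<Rightarrow> 'v" where
  "tm_val M e (Var n) = e n"
| "tm_val M e (App s ts) = fun_of M s (map (tm_val M e) ts)"

fun fo_sat :: "'v struct \<Rightarrow> (nat \<Rightarrow> 'v) \<Rightarrow> 'v fm \<Rightarrow> bool" where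
  "fo_sat M e (Eq t u) \<longleftrightarrow> tm_val M e t = tm_val M e u"
| "fo_sat M e (Atom s ts) \<longleftrightarrow> map (tm_val M e) ts \<in> rel_of M s"
| "fo_sat M e (Neg p) \<longleftrightarrow> \<not> fo_sat M e p"
| "fo_sat M e (Conj p q) \<longleftrightarrow> fo_sat M e p \<and> fo_sat M e q"
| "fo_sat M e (Exi n p) \<longleftrightarrow> (\<exists>a\<in>univ M. fo_sat M (e(n := a)) p)"

definition elementary_embedding :: "('v \<Rightarrow> 'v) \<Rightarrow> 'v struct \<Rightarrow> 'v struct \<Rightarrow> bool" where
  "elementary_embedding j M N \<longleftrightarrow>
     lang M = lang N \<and> j ` univ M \<subseteq> univ N \<and>
     (\<forall>p e. wf_fm (lang M) p \<longrightarrow> range e \<subseteq> univ M \<longrightarrow>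
        (fo_sat M e p \<longleftrightarrow> fo_sat N (j \<circ> e) p))"

definition Vopenka_Principle :: "'v::zfc itself \<Rightarrow> bool" where
  "Vopenka_Principle T \<longleftrightarrow>
     (\<forall>(\<tau> :: 'v language) (C :: 'v struct set).
        language \<tau> \<longrightarrow> (\<forall>M\<in>C. is_structure_of \<tau> M) \<longrightarrow> \<not> small TYPE('v) C \<longrightarrow>
        (\<exists>M\<in>C. \<exists>N\<in>C. M \<noteq> N \<and> (\<exists>j. elementary_embedding j M N)))"


section \<open>Abstract logics and the upward Loewenheim-Skolem-Tarski number\<close>

text \<open>
  A logic is a class function \<open>Sen\<close>, assigning to each language its set of sentences (sentences
  being sets), together with a class relation \<open>Sat\<close> between structures and sentences.
  Only values of \<open>Sen\<close> at set-sized languages are relevant.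
\<close>

locale logic =
  fixes Sen :: "'v::zfc language \<Rightarrow> 'v set"
    and Sat :: "'v struct \<Rightarrow> 'v \<Rightarrow> bool"
  assumes small_Sen: "language \<tau> \<Longrightarrow> small TYPE('v) (Sen \<tau>)"
    and Sat_dom: "Sat M \<phi> \<Longrightarrow> is_struct M \<and> \<phi> \<in> Sen (lang M)"
    and Sen_mono: "language \<sigma> \<Longrightarrow> \<tau> \<subseteq> \<sigma> \<Longrightarrow> Sen \<tau> \<subseteq> Sen \<sigma>"
    and Sat_reduct: "is_structure_of \<sigma> M \<Longrightarrow> \<tau> \<subseteq> \<sigma> \<Longrightarrow> \<phi> \<in> Sen \<tau> \<Longrightarrow>
      Sat M \<phi> \<longleftrightarrow> Sat (reduct \<tau> M) \<phi>"
    and Sat_iso: "is_struct M \<Longrightarrow> is_struct N \<Longrightarrow> isomorphic M N \<Longrightarrow> \<phi> \<in> Sen (lang M) \<Longrightarrow>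
      Sat M \<phi> \<longleftrightarrow> Sat N \<phi>"
    and Sat_renaming: "language \<tau> \<Longrightarrow> language \<sigma> \<Longrightarrow> renaming f \<tau> \<sigma> \<Longrightarrow>
      \<exists>g. bij_betw g (Sen \<tau>) (Sen \<sigma>) \<and>
          (\<forall>M \<phi>. is_structure_of \<tau> M \<longrightarrow> \<phi> \<in> Sen \<tau> \<longrightarrow> (Sat M \<phi> \<longleftrightarrow> Sat (rename f M) (g \<phi>)))"
    and occurrence_number: "\<exists>\<mu>::'v. cardinal \<mu> \<and>
      (\<forall>\<tau>. language \<tau> \<longrightarrow> (\<forall>\<phi>\<in>Sen \<tau>. \<exists>\<tau>'\<subseteq>\<tau>. \<tau>' \<prec> elts \<mu> \<and> \<phi> \<in> Sen \<tau>'))"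

definition ULST_property ::
  "('v::zfc language \<Rightarrow> 'v set) \<Rightarrow> ('v struct \<Rightarrow> 'v \<Rightarrow> bool) \<Rightarrow> 'v \<Rightarrow> bool" where
  "ULST_property Sen Sat \<delta> \<longleftrightarrow>
     (\<forall>\<tau> \<phi> M \<gamma> \<gamma>'.
        language \<tau> \<longrightarrow> \<phi> \<in> Sen \<tau> \<longrightarrow> is_structure_of \<tau> M \<longrightarrow> Sat M \<phi> \<longrightarrow>
        cardinal \<gamma> \<longrightarrow> univ M \<approx> elts \<gamma> \<longrightarrow> elts \<delta> \<subseteq> elts \<gamma> \<longrightarrow>
        cardinal \<gamma>' \<longrightarrow> \<gamma> \<in> elts \<gamma>' \<longrightarrow>
        (\<exists>N. is_structure_of \<tau> N \<and> elts \<gamma>' \<lesssim> univ N \<and> Sat N \<phi> \<and> substructure M N))"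

definition is_ULST ::
  "('v::zfc language \<Rightarrow> 'v set) \<Rightarrow> ('v struct \<Rightarrow> 'v \<Rightarrow> bool) \<Rightarrow> 'v \<Rightarrow> bool" where
  "is_ULST Sen Sat \<delta> \<longleftrightarrow>
     cardinal \<delta> \<and> ULST_property Sen Sat \<delta> \<and>
     (\<forall>\<delta>'. cardinal \<delta>' \<longrightarrow> ULST_property Sen Sat \<delta>' \<longrightarrow> elts \<delta> \<subseteq> elts \<delta>')"

end

theory Submission
  imports Defs
begin

text \<open>
  Assume Vopenka's Principle. Up to renaming, every sentence of a logic lives in a sublanguage of one
  fixed set-sized language, so it suffices to bound, for one sentence \<open>\<phi>\<close>, the sizes of the
  models without models of \<open>\<phi>\<close> of arbitrarily large size above them. If these sizes were unbounded,
  one could choose a proper class of such models with rapidly increasing sizes; an elementary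
  embedding between two of them turns the larger one into a forbidden extension of the smaller.

  Conversely, let \<open>C\<close> be a proper class of structures without elementary embeddings. Adding a
  relation for every formula makes substructures elementary. In the logic whose only sentences
  say, in some renaming, ``I am isomorphic to a member of \<open>C\<close>'', a large member of \<open>C\<close> has no
  properly larger extension satisfying the same sentence, so this logic has no ULST number.
\<close>

section \<open>Set-sized collections\<close>

text \<open>The ULST condition asks for literal extensions, whereas Vopenka's Principle yields only
  embeddings. The gap is closed by copying the target: the image of the smaller model is replaced by
  that model itself, all other points by fresh elements, and isomorphism invariance of the logic
  keeps the sentence true. The fixed language consists of the symbols with names in
  \<open>elts \<mu>\<close>, for \<open>\<mu>\<close> an occurrence number. It has only a set of
  sublanguages, each with a set of sentences, so one cardinal dominates the bounds for all of them.
  In the converse, invariance under renaming is what forces the sentence to exist in every renaming.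
  If \<open>N\<close> extends a large \<open>M\<close> from \<open>C\<close> and is isomorphic to
  some \<open>M1\<close> in \<open>C\<close> (after Morleyization), then going from \<open>M\<close>
  through \<open>N\<close> to \<open>M1\<close> is elementary; hence \<open>M1\<close> is
  \<open>M\<close>, and \<open>N\<close> is no larger than \<open>M\<close>. That \<open>C\<close>
  has large members is also due to the absence of embeddings: on universes of bounded size there is
  only a set of structures up to isomorphism.\<close>

lemma lepoll_linear: "A \<lesssim> B \<or> B \<lesssim> A"
proof -
  have "ordLeq2 (card_of A) (card_of B) \<or> ordLeq2 (card_of B) (card_of A)"
    by (intro ordLeq_total card_of_Well_order)
  then show ?thesis
    by (simp add: lepoll_def card_of_ordLeq)
qed

lemma small_elts [simp]: "small TYPE('v) (elts (x::'v::zfc))"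
  unfolding small_def by blast

lemma small_lepoll: "B \<lesssim> A \<Longrightarrow> small T A \<Longrightarrow> small T B"
  unfolding small_def using lepoll_trans by blast

lemma small_subset: "B \<subseteq> A \<Longrightarrow> small T A \<Longrightarrow> small T B"
  using small_lepoll subset_imp_lepoll by blast

lemma small_image: "small T A \<Longrightarrow> small T (f ` A)"
  using small_lepoll image_lepoll by blast

lemma empty_set_exists: "\<exists>z::'v::zfc. elts z = {}"
  using infinity by blast

text \<open>Replacement suffices: some function on a set covers \<open>A\<close>, and redirecting
  its values outside \<open>A\<close> to a fixed element of \<open>A\<close> makes the image exactly
  \<open>A\<close>. The empty collection has no such element and is treated apart.\<close>

lemma small_vset:
  fixes A :: "'v::zfc set"
  assumes "small TYPE('v) A"
  shows "\<exists>z. elts z = A"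
proof (cases "A = {}")
  case True
  then show ?thesis using empty_set_exists by metis
next
  case False
  obtain x :: 'v and g where g: "A \<subseteq> g ` elts x"
    using assms by (auto simp: small_def lepoll_iff)
  obtain a where a: "a \<in> A" using False by blast
  define h where "h = (\<lambda>y. if g y \<in> A then g y else a)"
  have "h ` elts x = A"
    using g a by (auto simp: h_def image_iff)
  then show ?thesis using replacement [of h x] by metis
qed

lemma not_mem_self: "(x::'v::zfc) \<notin> elts x"
  using wf_not_refl [OF foundation, of x] by simp

lemma not_small_UNIV: "\<not> small TYPE('v) (UNIV :: 'v::zfc set)"
  using small_vset not_mem_self by blast

text \<open>A finite inductive set would have a \<open>\<in>\<close>-maximal element, because the
  converse of a finite acyclic relation is well-founded; but its successor lies in the set and
  contains it.\<close>

lemma infinite_set_exists: "\<exists>z::'v::zfc. infinite (elts z)"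
proof -
  obtain z :: 'v where z: "\<exists>e\<in>elts z. elts e = {}"
      "\<forall>x\<in>elts z. \<exists>y\<in>elts z. elts y = insert x (elts x)"
    using infinity by blast
  have "infinite (elts z)"
  proof
    assume fin: "finite (elts z)"
    define r where "r = {(x, y). x \<in> elts y} \<inter> elts z \<times> elts z"
    have "finite r" using fin by (auto simp: r_def)
    moreover have "acyclic r"
      unfolding r_def by (rule wf_acyclic [OF wf_subset [OF foundation Int_lower1]])
    ultimately have "wf (r\<inverse>)" by (rule finite_acyclic_wf_converse)
    moreover obtain e where "e \<in> elts z" using z(1) by blast
    ultimately obtain m where m: "m \<in> elts z" "\<And>y. (y, m) \<in> r\<inverse> \<Longrightarrow> y \<notin> elts z"
      by (rule wfE_min) blast
    obtain y where y: "y \<in> elts z" "elts y = insert m (elts m)" using z(2) m(1) by blast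
    then have "(y, m) \<in> r\<inverse>" using m(1) by (simp add: r_def)
    then show False using m(2) y(1) by blast
  qed
  then show ?thesis by blast
qed

lemma small_UNIV_nat: "small (T :: 'v::zfc itself) (UNIV :: nat set)"
  using infinite_set_exists unfolding small_def infinite_le_lepoll by blast

lemma ex_union: "\<exists>z::'v::zfc. elts z = elts x \<union> elts y"
proof -
  obtain p where "elts p = {x, y}" using pairing by blast
  then show ?thesis using union [of p] by auto
qed

text \<open>No ordered pairs are coded as sets. Both factors inject into one infinite set
  \<open>z\<close>, whose square is equipollent to it; \<open>i\<close> is adjoined to make
  \<open>z\<close> infinite.\<close>

lemma small_Times:
  fixes T :: "'v::zfc itself"
  assumes "small T A" "small T B"
  shows "small T (A \<times> B)"
proof -
  obtain x y :: 'v where xy: "A \<lesssim> elts x" "B \<lesssim> elts y"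
    using assms by (auto simp: small_def)
  obtain i :: 'v where i: "infinite (elts i)" using infinite_set_exists by blast
  obtain w :: 'v where w: "elts w = elts x \<union> elts y" using ex_union by blast
  obtain z where z: "elts z = elts w \<union> elts i" using ex_union by blast
  have "infinite (elts z)" using i z by simp
  then have "elts z \<times> elts z \<approx> elts z"
    by (simp add: eqpoll_iff_card_of_ordIso card_of_Times_same_infinite)
  moreover have "A \<times> B \<lesssim> elts z \<times> elts z"
  proof (rule times_lepoll_mono)
    show "A \<lesssim> elts z"
      by (rule lepoll_trans [OF xy(1) subset_imp_lepoll]) (use w z in blast)
    show "B \<lesssim> elts z"
      by (rule lepoll_trans [OF xy(2) subset_imp_lepoll]) (use w z in blast)
  qed
  ultimately show ?thesis
    unfolding small_def using lepoll_trans2 by blast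
qed

text \<open>Each element \<open>b\<close> of the union is determined by a chosen index
  \<open>c b\<close> together with its image under the injection belonging to that index, so the
  union injects into a product of small collections.\<close>

lemma small_UN:
  fixes T :: "'v::zfc itself"
  assumes A: "small T A" and F: "\<And>a. a \<in> A \<Longrightarrow> small T (F a)"
  shows "small T (\<Union>a\<in>A. F a)"
proof -
  have "\<exists>(x::'v) i. inj_on i (F a) \<and> i ` F a \<subseteq> elts x" if "a \<in> A" for a
    using F [OF that] by (auto simp: small_def lepoll_def)
  then obtain X :: "_ \<Rightarrow> 'v" and i
    where i: "\<And>a. a \<in> A \<Longrightarrow> inj_on (i a) (F a)" "\<And>a. a \<in> A \<Longrightarrow> i a ` F a \<subseteq> elts (X a)"
    by metis
  have "small TYPE('v) (X ` A)" using A by (metis small_image small_def)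
  then obtain z where z: "elts z = X ` A" using small_vset by blast
  obtain u where u: "elts u = (\<Union>y\<in>elts z. elts y)" using union by blast
  define c where "c b = (SOME a. a \<in> A \<and> b \<in> F a)" for b
  have c: "c b \<in> A \<and> b \<in> F (c b)" if "b \<in> (\<Union>a\<in>A. F a)" for b
    unfolding c_def by (rule someI_ex) (use that in blast)
  have "inj_on (\<lambda>b. (c b, i (c b) b)) (\<Union>a\<in>A. F a)"
  proof (rule inj_onI)
    fix b b'
    assume b: "b \<in> (\<Union>a\<in>A. F a)" "b' \<in> (\<Union>a\<in>A. F a)"
      and e: "(c b, i (c b) b) = (c b', i (c b') b')"
    have eq: "c b = c b'" using arg_cong [OF e, of fst] by (simp only: fst_conv)
    have "i (c b) b = i (c b') b'" using arg_cong [OF e, of snd] by (simp only: snd_conv)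
    then have "i (c b) b = i (c b) b'" by (simp only: eq)
    moreover have "b \<in> F (c b)" "b' \<in> F (c b)" "c b \<in> A"
      using c [OF b(1)] c [OF b(2)] eq by auto
    ultimately show "b = b'"
      using inj_onD [OF i(1)] by blast
  qed
  moreover have "(\<lambda>b. (c b, i (c b) b)) ` (\<Union>a\<in>A. F a) \<subseteq> A \<times> elts u"
  proof (intro image_subsetI SigmaI)
    fix b assume "b \<in> (\<Union>a\<in>A. F a)"
    then have *: "c b \<in> A" "b \<in> F (c b)" using c by blast+
    then show "c b \<in> A" by blast
    have "i (c b) b \<in> elts (X (c b))" using * i(2) by blast
    then show "i (c b) b \<in> elts u" using * by (auto simp: u z)
  qed
  ultimately have "(\<Union>a\<in>A. F a) \<lesssim> A \<times> elts u" unfolding lepoll_def by blast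
  moreover have "small T (elts u)" unfolding small_def by blast
  ultimately show ?thesis using A small_Times small_lepoll by blast
qed

lemma small_Un:
  fixes T :: "'v::zfc itself"
  assumes "small T A" "small T B"
  shows "small T (A \<union> B)"
proof -
  have "small T {False, True}"
    by (rule small_lepoll [OF finite_lepoll_infinite small_UNIV_nat]) auto
  then have "small T (\<Union>b\<in>{False, True}. if b then A else B)"
    using assms by (intro small_UN) auto
  then show ?thesis by (simp add: Un_commute)
qed

lemma small_Pow:
  fixes T :: "'v::zfc itself"
  assumes "small T A"
  shows "small T (Pow A)"
proof -
  obtain x :: 'v and i where i: "inj_on i A" "i ` A \<subseteq> elts x"
    using assms by (auto simp: small_def lepoll_def)
  obtain p where p: "elts p = {y. elts y \<subseteq> elts x}" using powerset by blast
  have "\<exists>y. elts y = i ` S" if "S \<subseteq> A" for S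
    using that i by (intro small_vset small_subset [OF _ small_elts [of x]]) auto
  then have "\<forall>S\<in>Pow A. \<exists>y. elts y = i ` S" by simp
  then obtain c where c: "\<forall>S\<in>Pow A. elts (c S) = i ` S" by (rule bchoice [THEN exE])
  have "inj_on c (Pow A)"
  proof (rule inj_onI)
    fix S S' assume S: "S \<in> Pow A" "S' \<in> Pow A" "c S = c S'"
    then have "i ` S = i ` S'" using c by metis
    then show "S = S'" using S inj_on_image_eq_iff [OF i(1)] by blast
  qed
  moreover have "c ` Pow A \<subseteq> elts p"
  proof (rule image_subsetI)
    fix S assume "S \<in> Pow A"
    then have "elts (c S) = i ` S" "S \<subseteq> A" using c by blast+
    then show "c S \<in> elts p" using i(2) by (auto simp: p)
  qed
  ultimately show ?thesis unfolding small_def lepoll_def by blast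
qed

lemma small_lists:
  fixes T :: "'v::zfc itself"
  assumes "small T A"
  shows "small T (lists A)"
proof -
  have *: "small T {xs \<in> lists A. length xs = n}" for n :: nat
  proof (induction n)
    case 0
    have "{xs \<in> lists A. length xs = 0} = {[]}" by auto
    then show ?case
      by (simp add: small_lepoll [OF finite_lepoll_infinite small_UNIV_nat])
  next
    case (Suc n)
    have "{xs \<in> lists A. length xs = Suc n} \<subseteq>
        (\<lambda>(x, xs). x # xs) ` (A \<times> {xs \<in> lists A. length xs = n})"
      by (force simp: length_Suc_conv)
    then show ?case
      by (rule small_subset) (intro small_image small_Times assms Suc)
  qed
  have "lists A = (\<Union>n. {xs \<in> lists A. length xs = n})" by auto
  also have "small T \<dots>" by (intro small_UN small_UNIV_nat *)
  finally show ?thesis .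
qed


section \<open>Ordinals and cardinals\<close>

lemma ordinal_mem: "ordinal \<alpha> \<Longrightarrow> \<beta> \<in> elts \<alpha> \<Longrightarrow> ordinal \<beta>"
  unfolding ordinal_def transitive_set_def by blast

lemma ordinal_subset: "ordinal \<alpha> \<Longrightarrow> \<beta> \<in> elts \<alpha> \<Longrightarrow> elts \<beta> \<subseteq> elts \<alpha>"
  unfolding ordinal_def transitive_set_def by blast

lemma mem_induct:
  assumes "\<And>x. (\<And>y. y \<in> elts x \<Longrightarrow> P y) \<Longrightarrow> P x"
  shows "P (x::'v::zfc)"
  using foundation
proof (induction x rule: wf_induct_rule)
  case (less x)
  then show ?case using assms [of x] by simp
qed

lemma mem_minimal:
  assumes "P (x::'v::zfc)"
  obtains m where "P m" "\<And>y. y \<in> elts m \<Longrightarrow> \<not> P y"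
proof -
  obtain m where "m \<in> {x. P x}" "\<And>y. (y, m) \<in> {(x, y). x \<in> elts y} \<Longrightarrow> y \<notin> {x. P x}"
    using assms by (rule_tac wfE_min [OF foundation, of x "{x. P x}"]) simp_all
  then show thesis by (intro that [of m]) simp_all
qed

text \<open>Nested \<open>\<in>\<close>-induction, on \<open>\<alpha>\<close> for all
  \<open>\<beta>\<close> and then on \<open>\<beta>\<close>: if two ordinals are incomparable while
  their elements compare as required, each is included in the other, so extensionality identifies
  them.\<close>

lemma ordinal_linear:
  assumes "ordinal (\<alpha>::'v::zfc)" "ordinal \<beta>"
  shows "\<alpha> \<in> elts \<beta> \<or> \<alpha> = \<beta> \<or> \<beta> \<in> elts \<alpha>"
proof -
  have "\<forall>\<beta>. ordinal \<alpha> \<longrightarrow> ordinal \<beta> \<longrightarrow> \<alpha> \<in> elts \<beta> \<or> \<alpha> = \<beta> \<or> \<beta> \<in> elts \<alpha>"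
  proof (rule mem_induct [of _ \<alpha>])
    fix \<alpha> :: 'v
    assume IH: "\<And>x. x \<in> elts \<alpha> \<Longrightarrow>
      \<forall>\<beta>. ordinal x \<longrightarrow> ordinal \<beta> \<longrightarrow> x \<in> elts \<beta> \<or> x = \<beta> \<or> \<beta> \<in> elts x"
    show "\<forall>\<beta>. ordinal \<alpha> \<longrightarrow> ordinal \<beta> \<longrightarrow> \<alpha> \<in> elts \<beta> \<or> \<alpha> = \<beta> \<or> \<beta> \<in> elts \<alpha>"
    proof
      fix \<beta>
      show "ordinal \<alpha> \<longrightarrow> ordinal \<beta> \<longrightarrow> \<alpha> \<in> elts \<beta> \<or> \<alpha> = \<beta> \<or> \<beta> \<in> elts \<alpha>"
      proof (rule mem_induct [of _ \<beta>], intro impI)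
        fix \<beta> :: 'v
        assume IH2: "\<And>y. y \<in> elts \<beta> \<Longrightarrow> ordinal \<alpha> \<longrightarrow> ordinal y \<longrightarrow>
            \<alpha> \<in> elts y \<or> \<alpha> = y \<or> y \<in> elts \<alpha>"
          and o: "ordinal \<alpha>" "ordinal \<beta>"
        show "\<alpha> \<in> elts \<beta> \<or> \<alpha> = \<beta> \<or> \<beta> \<in> elts \<alpha>"
        proof (rule ccontr)
          assume n: "\<not> ?thesis"
          have "x \<in> elts \<beta>" if "x \<in> elts \<alpha>" for x
          proof -
            have "x \<in> elts \<beta> \<or> x = \<beta> \<or> \<beta> \<in> elts x"
              using IH [OF that] o ordinal_mem [OF o(1) that] by blast
            then show ?thesis using n that ordinal_subset [OF o(1) that] by blast
          qed
          moreover have "y \<in> elts \<alpha>" if "y \<in> elts \<beta>" for y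
          proof -
            have "\<alpha> \<in> elts y \<or> \<alpha> = y \<or> y \<in> elts \<alpha>"
              using IH2 [OF that] o ordinal_mem [OF o(2) that] by blast
            then show ?thesis using n that ordinal_subset [OF o(2) that] by blast
          qed
          ultimately have "elts \<alpha> = elts \<beta>" by blast
          then show False using n extensionality by blast
        qed
      qed
    qed
  qed
  then show ?thesis using assms by blast
qed

lemma ordinal_subset_or_mem:
  assumes "ordinal (\<alpha>::'v::zfc)" "ordinal \<beta>"
  shows "elts \<alpha> \<subseteq> elts \<beta> \<or> \<beta> \<in> elts \<alpha>"
  using ordinal_linear [OF assms] ordinal_subset [OF assms(2), of \<alpha>] by blast

lemma cardinal_subset:
  assumes "cardinal (\<kappa>::'v::zfc)" "cardinal \<nu>" "elts \<kappa> \<lesssim> elts \<nu>"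
  shows "elts \<kappa> \<subseteq> elts \<nu>"
proof -
  have "\<nu> \<notin> elts \<kappa>"
  proof
    assume "\<nu> \<in> elts \<kappa>"
    moreover from this have "elts \<nu> \<lesssim> elts \<kappa>"
      using assms(1) by (simp add: cardinal_def ordinal_subset subset_imp_lepoll)
    ultimately show False
      using assms lepoll_antisym unfolding cardinal_def by blast
  qed
  then show ?thesis
    using assms ordinal_subset_or_mem [of \<kappa> \<nu>] by (simp add: cardinal_def)
qed

text \<open>The ordinal is the Mostowski collapse of a strict well-order \<open>R\<close> of
  \<open>A\<close>. The collapse is injective since two points with equal values, being comparable,
  would give a set that is an element of itself.\<close>

lemma small_eqpoll_ordinal:
  fixes A :: "'b set"
  assumes A: "small TYPE('v::zfc) A"
  shows "\<exists>\<alpha>::'v. ordinal \<alpha> \<and> elts \<alpha> \<approx> A"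
proof -
  obtain r where r: "well_order_on A r" using well_order_on by blast
  define R where "R = r - Id"
  have wf: "wf R" using r by (simp add: R_def well_order_on_def)
  have RA: "b \<in> A \<and> a \<in> A" if "(b, a) \<in> R" for a b
    using r that unfolding R_def well_order_on_def linear_order_on_def partial_order_on_def
      preorder_on_def by blast
  have trans: "(c, a) \<in> R" if "(c, b) \<in> R" "(b, a) \<in> R" for a b c
    using r that unfolding R_def well_order_on_def linear_order_on_def partial_order_on_def
      preorder_on_def trans_def antisym_def by blast
  have total: "(a, b) \<in> R \<or> (b, a) \<in> R" if "a \<in> A" "b \<in> A" "a \<noteq> b" for a b
    using r that unfolding R_def well_order_on_def linear_order_on_def total_on_def by blast
  define f :: "'b \<Rightarrow> 'v"
    where "f = wfrec R (\<lambda>g a. SOME z. elts z = g ` {b. (b, a) \<in> R})"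
  have elts_f: "elts (f a) = f ` {b. (b, a) \<in> R}" for a
  proof -
    have "f a = (SOME z. elts z = cut f R a ` {b. (b, a) \<in> R})"
      unfolding f_def by (subst wfrec [OF wf]) simp
    also have "cut f R a ` {b. (b, a) \<in> R} = f ` {b. (b, a) \<in> R}"
      by (auto simp: cut_def image_iff)
    finally have "f a = (SOME z. elts z = f ` {b. (b, a) \<in> R})" .
    moreover have "\<exists>z. elts z = f ` {b. (b, a) \<in> R}"
      using A RA by (intro small_vset small_image) (auto intro: small_subset)
    ultimately show ?thesis by (metis (mono_tags, lifting) someI_ex)
  qed
  have tr: "transitive_set (f a)" for a
    unfolding transitive_set_def using trans by (auto simp: elts_f)
  obtain \<alpha> where \<alpha>: "elts \<alpha> = f ` A" using small_vset small_image A by blast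
  have "transitive_set \<alpha>"
    unfolding transitive_set_def using RA by (auto simp: \<alpha> elts_f)
  then have "ordinal \<alpha>" unfolding ordinal_def using \<alpha> tr by auto
  moreover have "inj_on f A"
  proof (rule inj_onI, rule ccontr)
    fix a b assume "a \<in> A" "b \<in> A" "f a = f b" "a \<noteq> b"
    then have "f a \<in> elts (f b) \<or> f b \<in> elts (f a)" using total elts_f by blast
    then show False using \<open>f a = f b\<close> not_mem_self by auto
  qed
  ultimately show ?thesis using \<alpha> inj_on_image_eqpoll_self by metis
qed

lemma small_eqpoll_cardinal:
  fixes A :: "'b set"
  assumes "small TYPE('v::zfc) A"
  shows "\<exists>\<kappa>::'v. cardinal \<kappa> \<and> elts \<kappa> \<approx> A"
proof -
  obtain \<alpha> :: 'v where "ordinal \<alpha> \<and> elts \<alpha> \<approx> A" using small_eqpoll_ordinal [OF assms] by blast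
  then obtain \<kappa> :: 'v where \<kappa>: "ordinal \<kappa> \<and> elts \<kappa> \<approx> A"
    and min: "\<And>y. y \<in> elts \<kappa> \<Longrightarrow> \<not> (ordinal y \<and> elts y \<approx> A)"
    by (rule mem_minimal) blast
  have "cardinal \<kappa>"
    unfolding cardinal_def
  proof (intro conjI ballI notI)
    fix \<beta> assume \<beta>: "\<beta> \<in> elts \<kappa>" "elts \<beta> \<approx> elts \<kappa>"
    then have "elts \<beta> \<approx> A" using \<kappa> eqpoll_trans by blast
    then show False using min \<beta>(1) \<kappa> ordinal_mem by blast
  qed (use \<kappa> in simp)
  then show ?thesis using \<kappa> by blast
qed

lemma larger_cardinal:
  assumes A: "small TYPE('v::zfc) A"
  shows "\<exists>\<kappa>::'v. cardinal \<kappa> \<and> A \<prec> elts \<kappa>"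
proof -
  obtain \<kappa> :: 'v where "cardinal \<kappa>" "elts \<kappa> \<approx> Pow A"
    using small_eqpoll_cardinal [OF small_Pow [OF A]] by blast
  then show ?thesis using lesspoll_Pow_self lesspoll_eq_trans eqpoll_sym by blast
qed

lemma lesspoll_cardinal_mem:
  assumes "cardinal (\<gamma>::'v::zfc)" "cardinal \<kappa>" "elts \<gamma> \<prec> elts \<kappa>"
  shows "\<gamma> \<in> elts \<kappa>"
proof -
  have "\<not> elts \<kappa> \<subseteq> elts \<gamma>"
    using assms(3) lepoll_antisym subset_imp_lepoll unfolding lesspoll_def by blast
  then show ?thesis
    using assms ordinal_subset_or_mem [of \<kappa> \<gamma>] by (simp add: cardinal_def)
qed

text \<open>Foundation gives a \<open>\<in>\<close>-minimal cardinal with the property, and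
  comparability of ordinals makes it the least one. Thus only some bound has to be found, not the
  exact ULST number.\<close>

lemma is_ULST_exists:
  assumes "cardinal (\<delta>::'v::zfc)" "ULST_property Sen Sat \<delta>"
  shows "\<exists>\<delta>. is_ULST Sen Sat \<delta>"
proof -
  obtain m where m: "cardinal m \<and> ULST_property Sen Sat m"
    and min: "\<And>y. y \<in> elts m \<Longrightarrow> \<not> (cardinal y \<and> ULST_property Sen Sat y)"
    using mem_minimal [of "\<lambda>\<delta>. cardinal \<delta> \<and> ULST_property Sen Sat \<delta>" \<delta>] assms by blast
  have "is_ULST Sen Sat m"
    unfolding is_ULST_def
  proof (intro conjI allI impI)
    fix \<delta>' assume "cardinal \<delta>'" "ULST_property Sen Sat \<delta>'"
    then show "elts m \<subseteq> elts \<delta>'"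
      using m min ordinal_subset_or_mem [of m \<delta>'] by (auto simp: cardinal_def)
  qed (use m in auto)
  then show ?thesis by blast
qed

section \<open>Embeddings and extensions\<close>

text \<open>The usual model-theoretic embedding, with relations reflected as well as preserved. This
  is all that the construction of an extension takes from an elementary embedding.\<close>

definition embedding :: "('v \<Rightarrow> 'v) \<Rightarrow> 'v struct \<Rightarrow> 'v struct \<Rightarrow> bool" where
  "embedding j M N \<longleftrightarrow>
     lang M = lang N \<and> inj_on j (univ M) \<and> j ` univ M \<subseteq> univ N \<and>
     (\<forall>s\<in>lang M. is_Rel s \<longrightarrow>
        (\<forall>xs\<in>tuples (univ M) (arity s). xs \<in> rel_of M s \<longleftrightarrow> map j xs \<in> rel_of N s)) \<and>
     (\<forall>s\<in>lang M. is_Fun s \<longrightarrow>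
        (\<forall>xs\<in>tuples (univ M) (arity s). j (fun_of M s xs) = fun_of N s (map j xs)))"

lemma is_structD:
  assumes "is_struct M"
  shows "\<And>s. s \<in> lang M \<Longrightarrow> is_Rel s \<Longrightarrow> rel_of M s \<subseteq> tuples (univ M) (arity s)"
    and "\<And>s. \<not> (s \<in> lang M \<and> is_Rel s) \<Longrightarrow> rel_of M s = {}"
    and "\<And>s xs. s \<in> lang M \<Longrightarrow> is_Fun s \<Longrightarrow> xs \<in> tuples (univ M) (arity s) \<Longrightarrow>
      fun_of M s xs \<in> univ M"
    and "\<And>s xs. \<not> (s \<in> lang M \<and> is_Fun s \<and> xs \<in> tuples (univ M) (arity s)) \<Longrightarrow>
      fun_of M s xs = undefined"
  using assms unfolding is_struct_def by meson+

text \<open>Elementarity is applied to three kinds of formulas: an equation of two variables for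
  injectivity, \<open>R(v0,...)\<close> for relations, and an equation between a variable and
  \<open>F(v0,...)\<close> for functions.\<close>

lemma elementary_embedding_imp_embedding:
  assumes M: "is_struct M" and j: "elementary_embedding j M N"
  shows "embedding j M N"
proof -
  have lang: "lang M = lang N" and sub: "j ` univ M \<subseteq> univ N"
    and el: "\<And>p e. wf_fm (lang M) p \<Longrightarrow> range e \<subseteq> univ M \<Longrightarrow>
      fo_sat M e p \<longleftrightarrow> fo_sat N (j \<circ> e) p"
    using j unfolding elementary_embedding_def by blast+
  obtain a0 where a0: "a0 \<in> univ M" using M unfolding is_struct_def by blast
  \<comment> \<open>Elementarity speaks of total valuations into the universe, so every variable
    beyond the tuple needs a value there: the default \<open>b\<close>.\<close>
  define env where "env xs b = (\<lambda>i. if i < length xs then xs ! i else b)" for xs and b :: 'a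
  have range_env: "range (env xs b) \<subseteq> univ M" if "set xs \<subseteq> univ M" "b \<in> univ M" for xs b
    using that by (auto simp: env_def)
  have val: "map (tm_val M (env xs b)) (map Var [0..<length xs]) = xs"
      "map (tm_val N (j \<circ> env xs b)) (map Var [0..<length xs]) = map j xs" for xs b
    by (auto simp: env_def intro: nth_equalityI)
  have "inj_on j (univ M)"
  proof (rule inj_onI)
    fix a b assume ab: "a \<in> univ M" "b \<in> univ M" "j a = j b"
    have "fo_sat M (env [a] b) (Eq (Var 0) (Var 1)) \<longleftrightarrow>
        fo_sat N (j \<circ> env [a] b) (Eq (Var 0) (Var 1))"
      using ab by (intro el range_env) auto
    then show "a = b" using ab by (simp add: env_def)
  qed
  moreover have "xs \<in> rel_of M s \<longleftrightarrow> map j xs \<in> rel_of N s"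
    if "s \<in> lang M" "is_Rel s" "xs \<in> tuples (univ M) (arity s)" for s xs
  proof -
    have xs: "length xs = arity s" "set xs \<subseteq> univ M" using that(3) by (auto simp: tuples_def)
    have "fo_sat M (env xs a0) (Atom s (map Var [0..<length xs])) \<longleftrightarrow>
        fo_sat N (j \<circ> env xs a0) (Atom s (map Var [0..<length xs]))"
      using xs that a0 by (intro el range_env) auto
    then show ?thesis by (simp only: fo_sat.simps val)
  qed
  moreover have "j (fun_of M s xs) = fun_of N s (map j xs)"
    if "s \<in> lang M" "is_Fun s" "xs \<in> tuples (univ M) (arity s)" for s xs
  proof -
    have xs: "length xs = arity s" "set xs \<subseteq> univ M" using that(3) by (auto simp: tuples_def)
    \<comment> \<open>The default is the function value itself. Hence the first variable beyond the
      arguments, with index \<open>length xs\<close>, denotes \<open>fun_of M s xs\<close>.\<close>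
    define e where "e = env xs (fun_of M s xs)"
    have "fo_sat M e (Eq (Var (length xs)) (App s (map Var [0..<length xs]))) \<longleftrightarrow>
        fo_sat N (j \<circ> e) (Eq (Var (length xs)) (App s (map Var [0..<length xs])))"
      unfolding e_def using xs that is_structD(3) [OF M] by (intro el range_env) auto
    moreover have "e (length xs) = fun_of M s xs" by (simp add: e_def env_def)
    ultimately show ?thesis
      using val [of xs "fun_of M s xs"]
      unfolding e_def [symmetric] fo_sat.simps tm_val.simps comp_apply by metis
  qed
  ultimately show ?thesis unfolding embedding_def using lang sub by blast
qed

section \<open>Isomorphic copies, extensions and expansions of structures\<close>

text \<open>The copy of \<open>N\<close> along \<open>k\<close>. The guard on functions supplies the
  default \<open>undefined\<close> that \<open>is_struct\<close> demands; relations outside the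
  language stay empty under the image.\<close>

definition transport :: "('v \<Rightarrow> 'v) \<Rightarrow> 'v struct \<Rightarrow> 'v struct" where
  "transport k N =
     \<lparr>lang = lang N, univ = k ` univ N,
      rel_of = (\<lambda>s. map k ` rel_of N s),
      fun_of = (\<lambda>s xs. if s \<in> lang N \<and> is_Fun s \<and> xs \<in> tuples (k ` univ N) (arity s)
                       then k (fun_of N s (map (inv_into (univ N) k) xs)) else undefined)\<rparr>"

lemma map_tuples: "xs \<in> tuples A n \<Longrightarrow> h ` A \<subseteq> B \<Longrightarrow> map h xs \<in> tuples B n"
  unfolding tuples_def by auto

lemma map_inv_into_tuples:
  "inj_on k A \<Longrightarrow> xs \<in> tuples A n \<Longrightarrow> map (inv_into A k) (map k xs) = xs"
  unfolding tuples_def by (auto intro!: map_idI simp: subset_iff)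

lemma is_struct_transport:
  fixes N :: "'v::zfc struct"
  assumes N: "is_struct N"
  shows "is_struct (transport k N)"
  unfolding is_struct_def
proof (intro conjI allI)
  show "language (lang (transport k N))" "univ (transport k N) \<noteq> {}"
    using N by (auto simp: is_struct_def transport_def)
  show "small TYPE('v) (univ (transport k N))"
    using N by (simp add: is_struct_def transport_def small_image)
next
  fix s
  show "if s \<in> lang (transport k N) \<and> is_Rel s
      then rel_of (transport k N) s \<subseteq> tuples (univ (transport k N)) (arity s)
      else rel_of (transport k N) s = {}"
    using is_structD(1,2) [OF N, of s] map_tuples [of _ "univ N" "arity s" k "k ` univ N"]
    by (auto simp: transport_def)
next
  fix s :: "'v symbol" and xs
  have "map (inv_into (univ N) k) xs \<in> tuples (univ N) (arity s)"
    if "xs \<in> tuples (k ` univ N) (arity s)"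
    using map_tuples [OF that] by (metis image_subsetI inv_into_into)
  then show "if s \<in> lang (transport k N) \<and> is_Fun s \<and>
        xs \<in> tuples (univ (transport k N)) (arity s)
      then fun_of (transport k N) s xs \<in> univ (transport k N)
      else fun_of (transport k N) s xs = undefined"
    using is_structD(3) [OF N, of s] by (auto simp: transport_def)
qed

lemma isomorphic_transport:
  assumes N: "is_struct N" and k: "inj_on k (univ N)"
  shows "isomorphic N (transport k N)"
proof -
  have "xs \<in> rel_of N s \<longleftrightarrow> map k xs \<in> rel_of (transport k N) s"
    if s: "s \<in> lang N" "is_Rel s" and xs: "xs \<in> tuples (univ N) (arity s)" for s xs
  proof
    assume "map k xs \<in> rel_of (transport k N) s"
    then obtain ys where ys: "ys \<in> rel_of N s" "map k xs = map k ys"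
      by (auto simp: transport_def)
    then have "ys \<in> tuples (univ N) (arity s)" using is_structD(1) [OF N s] by blast
    then have "xs = ys" using map_inv_into_tuples [OF k] xs ys(2) by metis
    then show "xs \<in> rel_of N s" using ys by simp
  qed (simp add: transport_def)
  moreover have "k (fun_of N s xs) = fun_of (transport k N) s (map k xs)"
    if s: "s \<in> lang N" "is_Fun s" and xs: "xs \<in> tuples (univ N) (arity s)" for s xs
    using map_inv_into_tuples [OF k xs] map_tuples [OF xs order_refl [of "k ` univ N"]] s
    by (simp add: transport_def)
  ultimately show ?thesis
    unfolding isomorphic_def
    by (intro conjI exI [of _ k]) (auto simp: transport_def bij_betw_def k)
qed

text \<open>The copy of \<open>N\<close> arises by undoing \<open>j\<close> on its image and moving
  the remaining points outside \<open>univ M\<close>. The universe of sets leaves room for this,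
  since the complement of a small collection is not small.\<close>

lemma embedding_imp_extension:
  fixes M N :: "'v::zfc struct"
  assumes M: "is_struct M" and N: "is_struct N" and j: "embedding j M N"
  obtains N' where "is_struct N'" "isomorphic N N'" "substructure M N'" "univ N \<approx> univ N'"
proof -
  have lang: "lang M = lang N" and inj: "inj_on j (univ M)" and sub: "j ` univ M \<subseteq> univ N"
    and rel: "\<And>s xs. s \<in> lang M \<Longrightarrow> is_Rel s \<Longrightarrow> xs \<in> tuples (univ M) (arity s) \<Longrightarrow>
      xs \<in> rel_of M s \<longleftrightarrow> map j xs \<in> rel_of N s"
    and fn: "\<And>s xs. s \<in> lang M \<Longrightarrow> is_Fun s \<Longrightarrow> xs \<in> tuples (univ M) (arity s) \<Longrightarrow>
      j (fun_of M s xs) = fun_of N s (map j xs)"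
    using j unfolding embedding_def by blast+
  have "\<not> small TYPE('v) (- univ M)"
  proof
    assume "small TYPE('v) (- univ M)"
    then have "small TYPE('v) (univ M \<union> - univ M)"
      using M by (intro small_Un) (simp_all add: is_struct_def)
    then show False using not_small_UNIV [where 'v = 'v] by simp
  qed
  moreover have "small TYPE('v) (univ N - j ` univ M)"
    using N by (rule_tac small_subset [of _ "univ N"]) (auto simp: is_struct_def)
  \<comment> \<open>By comparability, the alternative is that the complement of
    \<open>univ M\<close> injects into a small collection and so is small itself.\<close>
  ultimately have "univ N - j ` univ M \<lesssim> - univ M"
    using lepoll_linear small_lepoll by blast
  then obtain g where g: "inj_on g (univ N - j ` univ M)" "g ` (univ N - j ` univ M) \<subseteq> - univ M"
    unfolding lepoll_def by blast
  define k where "k y = (if y \<in> j ` univ M then inv_into (univ M) j y else g y)" for y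
  have kj: "k (j a) = a" if "a \<in> univ M" for a
    using that inj by (simp add: k_def)
  have k_out: "k y \<notin> univ M" if "y \<in> univ N" "y \<notin> j ` univ M" for y
    using that g(2) by (auto simp: k_def)
  have jk: "j (k y) = y" if "y \<in> univ N" "k y \<in> univ M" for y
  proof -
    have "y \<in> j ` univ M" using that k_out by blast
    then obtain a where "a \<in> univ M" "y = j a" by blast
    then show ?thesis using kj by simp
  qed
  have inj_k: "inj_on k (univ N)"
  proof (rule inj_onI)
    fix x y assume xy: "x \<in> univ N" "y \<in> univ N" "k x = k y"
    show "x = y"
    proof (cases "k x \<in> univ M")
      case True
      then have "j (k x) = x" using jk xy(1) by simp
      moreover have "j (k x) = y" using True jk [OF xy(2)] xy(3) by simp
      ultimately show ?thesis by simp
    next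
      case False
      then have "x \<notin> j ` univ M" "y \<notin> j ` univ M" using kj xy(3) by auto
      then show ?thesis using xy inj_onD [OF g(1), of x y] by (simp add: k_def)
    qed
  qed
  have inv_k: "inv_into (univ N) k a = j a" if "a \<in> univ M" for a
    using inv_into_f_f [OF inj_k, of "j a"] kj [OF that] sub that by auto
  have map_kj: "map k (map j xs) = xs" if "xs \<in> tuples (univ M) n" for xs n
    using that kj by (auto intro!: map_idI simp: tuples_def subset_iff)
  have "substructure M (transport k N)"
    unfolding substructure_def
  proof (intro conjI ballI impI)
    show "lang M = lang (transport k N)" using lang by (simp add: transport_def)
    show "univ M \<subseteq> univ (transport k N)"
      using kj sub by (force simp: transport_def)
  next
    fix s assume s: "s \<in> lang M" "is_Rel s"
    show "rel_of M s = rel_of (transport k N) s \<inter> tuples (univ M) (arity s)"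
    proof (intro equalityI subsetI)
      fix xs assume xs: "xs \<in> rel_of M s"
      then have t: "xs \<in> tuples (univ M) (arity s)" using is_structD(1) [OF M s] by blast
      then have "map j xs \<in> rel_of N s" using rel s xs by blast
      then show "xs \<in> rel_of (transport k N) s \<inter> tuples (univ M) (arity s)"
        using map_kj [OF t] t image_eqI [of xs "map k" "map j xs" "rel_of N s"]
        by (simp add: transport_def)
    next
      fix xs assume xs: "xs \<in> rel_of (transport k N) s \<inter> tuples (univ M) (arity s)"
      then obtain ys where ys: "ys \<in> rel_of N s" "xs = map k ys" by (auto simp: transport_def)
      then have "set ys \<subseteq> univ N"
        using is_structD(1) [OF N, of s] s lang by (auto simp: tuples_def)
      then have "map j xs = ys"
        using jk xs ys(2) by (auto intro!: map_idI simp: tuples_def subset_iff)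
      then show "xs \<in> rel_of M s" using rel s xs ys(1) by blast
    qed
  next
    fix s xs assume s: "s \<in> lang M" "is_Fun s" and xs: "xs \<in> tuples (univ M) (arity s)"
    have "univ M \<subseteq> k ` univ N" using kj sub by force
    then have "xs \<in> tuples (k ` univ N) (arity s)" using xs by (auto simp: tuples_def)
    moreover have "map (inv_into (univ N) k) xs = map j xs"
      using xs inv_k by (auto simp: tuples_def)
    ultimately have "fun_of (transport k N) s xs = k (j (fun_of M s xs))"
      using s lang fn [OF s xs] by (simp add: transport_def del: map_eq_conv)
    then show "fun_of M s xs = fun_of (transport k N) s xs"
      using kj is_structD(3) [OF M s xs] by simp
  qed
  moreover have "univ N \<approx> univ (transport k N)"
    using inj_k by (simp add: transport_def inj_on_image_eqpoll_self eqpoll_sym)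
  ultimately show thesis
    using that is_struct_transport [OF N] isomorphic_transport [OF N inj_k] by blast
qed

text \<open>Undoes the passage to a renamed sublanguage: an extension \<open>N\<close> found there
  is turned into an extension of the original \<open>M\<close> in the full language
  \<open>\<tau>\<close>. The symbols of \<open>\<tau>\<close> outside \<open>\<tau>'\<close> must be
  reinterpreted on the larger universe.\<close>

lemma expansion_along_renaming:
  fixes M N :: "'v::zfc struct"
  assumes M: "is_structure_of \<tau> M" and N: "is_structure_of \<sigma> N"
    and f: "renaming f \<tau>' \<sigma>" and \<tau>': "\<tau>' \<subseteq> \<tau>"
    and MN: "substructure (rename f (reduct \<tau>' M)) N"
  obtains N' where "is_structure_of \<tau> N'" "univ N' = univ N" "substructure M N'"
    "rename f (reduct \<tau>' N') = N"
proof -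
  have bij: "bij_betw f \<tau>' \<sigma>" and f_arity: "\<And>s. s \<in> \<tau>' \<Longrightarrow> arity (f s) = arity s"
    and f_rel: "\<And>s. s \<in> \<tau>' \<Longrightarrow> is_Rel (f s) \<longleftrightarrow> is_Rel s"
    using f unfolding renaming_def by blast+
  have f_fun: "is_Fun (f s) \<longleftrightarrow> is_Fun s" if "s \<in> \<tau>'" for s
    using f_rel [OF that] by (metis symbol.exhaust_disc symbol.disc(1,2,3,4) symbol.collapse)
  have f_mem: "f s \<in> \<sigma>" if "s \<in> \<tau>'" for s using bij that by (auto simp: bij_betw_def)
  have img: "f ` \<tau>' = \<sigma>" and inj: "inj_on f \<tau>'" using bij by (auto simp: bij_betw_def)
  have sM: "is_struct M" "lang M = \<tau>" and sN: "is_struct N" "lang N = \<sigma>"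
    using M N by (auto simp: is_structure_of_def)
  have inv: "inv_into \<tau>' f (f s) = s" if "s \<in> \<tau>'" for s using inj that by simp
  have sub: "univ M \<subseteq> univ N"
    using MN by (simp add: substructure_def rename_def reduct_def)
  have rel: "rel_of M s = rel_of N (f s) \<inter> tuples (univ M) (arity s)"
    if "s \<in> \<tau>'" "is_Rel s" for s
  proof -
    have "f s \<in> lang (rename f (reduct \<tau>' M))" using that by (simp add: rename_def reduct_def)
    then have "rel_of (rename f (reduct \<tau>' M)) (f s) =
        rel_of N (f s) \<inter> tuples (univ (rename f (reduct \<tau>' M))) (arity (f s))"
      using MN that f_rel unfolding substructure_def by blast
    then show ?thesis
      using that inv f_arity by (simp add: rename_def reduct_def)
  qed
  have fn: "fun_of M s xs = fun_of N (f s) xs"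
    if "s \<in> \<tau>'" "is_Fun s" "xs \<in> tuples (univ M) (arity s)" for s xs
  proof -
    have "f s \<in> lang (rename f (reduct \<tau>' M))" using that by (simp add: rename_def reduct_def)
    moreover have "xs \<in> tuples (univ (rename f (reduct \<tau>' M))) (arity (f s))"
      using that f_arity by (simp add: rename_def reduct_def)
    ultimately have "fun_of (rename f (reduct \<tau>' M)) (f s) xs = fun_of N (f s) xs"
      using MN that f_fun unfolding substructure_def by blast
    then show ?thesis
      using that inv by (simp add: rename_def reduct_def)
  qed
  obtain a where a: "a \<in> univ N" using sN unfolding is_struct_def by blast
  \<comment> \<open>Symbols outside \<open>\<tau>'\<close> are extended in the cheapest way:
    relations gain no tuples, and functions take the arbitrary value \<open>a\<close> on tuples not
    entirely in \<open>M\<close>.\<close>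
  define N' where "N' =
     \<lparr>lang = \<tau>, univ = univ N,
      rel_of = (\<lambda>s. if s \<in> \<tau>' then rel_of N (f s) else rel_of M s),
      fun_of = (\<lambda>s xs. if s \<in> \<tau>' then fun_of N (f s) xs
          else if s \<in> \<tau> \<and> is_Fun s \<and> xs \<in> tuples (univ N) (arity s)
          then if xs \<in> tuples (univ M) (arity s) then fun_of M s xs else a
          else undefined)\<rparr>"
  have tuples_mono: "tuples (univ M) n \<subseteq> tuples (univ N) n" for n
    using sub by (auto simp: tuples_def)
  have "is_struct N'"
    unfolding is_struct_def
  proof (intro conjI allI)
    show "language (lang N')" "small TYPE('v) (univ N')" "univ N' \<noteq> {}"
      using sM sN by (auto simp: is_struct_def N'_def)
  next
    fix s
    show "if s \<in> lang N' \<and> is_Rel s then rel_of N' s \<subseteq> tuples (univ N') (arity s)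
        else rel_of N' s = {}"
    proof (cases "s \<in> \<tau>'")
      case True
      then show ?thesis
        using is_structD(1,2) [OF sN(1), of "f s"] sN(2) f_mem f_rel f_arity \<tau>'
        by (auto simp: N'_def)
    next
      case False
      then show ?thesis
        using is_structD(1,2) [OF sM(1), of s] sM(2) tuples_mono [of "arity s"]
        by (auto simp: N'_def)
    qed
  next
    fix s xs
    show "if s \<in> lang N' \<and> is_Fun s \<and> xs \<in> tuples (univ N') (arity s)
        then fun_of N' s xs \<in> univ N' else fun_of N' s xs = undefined"
    proof (cases "s \<in> \<tau>'")
      case True
      then show ?thesis
        using is_structD(3,4) [OF sN(1), of "f s" xs] sN(2) f_mem f_fun f_arity \<tau>'
        by (auto simp: N'_def)
    next
      case False
      then show ?thesis
        using is_structD(3) [OF sM(1), of s xs] sM(2) sub a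
        by (auto simp: N'_def)
    qed
  qed
  moreover have "substructure M N'"
    unfolding substructure_def
  proof (intro conjI ballI impI)
    show "lang M = lang N'" "univ M \<subseteq> univ N'" using sM sub by (auto simp: N'_def)
  next
    fix s assume s: "s \<in> lang M" "is_Rel s"
    show "rel_of M s = rel_of N' s \<inter> tuples (univ M) (arity s)"
      using rel [OF _ s(2)] is_structD(1) [OF sM(1) s] by (auto simp: N'_def)
  next
    fix s xs assume s: "s \<in> lang M" "is_Fun s" and xs: "xs \<in> tuples (univ M) (arity s)"
    show "fun_of M s xs = fun_of N' s xs"
      using fn [OF _ s(2) xs] s xs sM(2) tuples_mono by (auto simp: N'_def)
  qed
  \<comment> \<open>Literal equality, not just isomorphism, is available because \<open>N\<close>
    has the prescribed default values outside its language.\<close>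
  moreover have "rename f (reduct \<tau>' N') = N"
  proof (rule struct.equality)
    show "lang (rename f (reduct \<tau>' N')) = lang N"
      using img sN by (simp add: rename_def reduct_def)
    show "univ (rename f (reduct \<tau>' N')) = univ N"
      by (simp add: rename_def reduct_def N'_def)
    have inv_mem: "inv_into \<tau>' f s \<in> \<tau>'" "f (inv_into \<tau>' f s) = s" if "s \<in> \<sigma>" for s
      using that img by (auto intro: inv_into_into f_inv_into_f)
    show "rel_of (rename f (reduct \<tau>' N')) = rel_of N"
      using inv_mem is_structD(2) [OF sN(1)] sN(2)
      by (auto simp: rename_def reduct_def N'_def img fun_eq_iff)
    show "fun_of (rename f (reduct \<tau>' N')) = fun_of N"
      using inv_mem is_structD(4) [OF sN(1)] sN(2)
      by (auto simp: rename_def reduct_def N'_def img fun_eq_iff)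
  qed simp
  ultimately show thesis
    using that [of N'] by (simp add: is_structure_of_def N'_def)
qed

section \<open>Vopenka's Principle bounds the structures without large extensions\<close>

text \<open>A model at which extension to size at least that of \<open>elts y\<close> fails. The
  language of the extension is fixed implicitly, since \<open>substructure\<close> requires equal
  languages.\<close>

definition unextendable :: "('v::zfc struct \<Rightarrow> 'v \<Rightarrow> bool) \<Rightarrow> 'v \<Rightarrow> 'v struct \<Rightarrow> 'v \<Rightarrow> bool" where
  "unextendable Sat \<phi> M y \<longleftrightarrow>
     is_struct M \<and> Sat M \<phi> \<and>
     \<not> (\<exists>N. is_struct N \<and> elts y \<lesssim> univ N \<and> Sat N \<phi> \<and> substructure M N)"

lemma substructure_refl: "is_struct M \<Longrightarrow> substructure M M"
  using is_structD(1) [of M] by (auto simp: substructure_def)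

text \<open>\<open>M\<close> extends itself, so the size that cannot be reached exceeds its
  own.\<close>

lemma unextendable_not_lepoll: "unextendable Sat \<phi> M y \<Longrightarrow> \<not> elts y \<lesssim> univ M"
  unfolding unextendable_def using substructure_refl by blast

text \<open>A model into which \<open>M\<close> embeds is isomorphic to an extension of
  \<open>M\<close>, so its size is caught between that of \<open>M\<close> and the forbidden
  size.\<close>

lemma (in logic) embedding_into_model:
  assumes M: "unextendable Sat \<phi> M y" and N: "Sat N \<phi>"
    and j: "elementary_embedding j M N"
  shows "univ M \<lesssim> univ N \<and> \<not> elts y \<lesssim> univ N"
proof -
  have sM: "is_struct M" using M unfolding unextendable_def by blast
  have sN: "is_struct N" "\<phi> \<in> Sen (lang N)" using Sat_dom [OF N] by blast+
  have e: "embedding j M N" by (rule elementary_embedding_imp_embedding [OF sM j])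
  obtain N' where N': "is_struct N'" "isomorphic N N'" "substructure M N'" "univ N \<approx> univ N'"
    by (rule embedding_imp_extension [OF sM sN(1) e])
  have "Sat N' \<phi>" using Sat_iso [OF sN(1) N'(1,2) sN(2)] N by blast
  then have "\<not> elts y \<lesssim> univ N'" using M N' unfolding unextendable_def by blast
  then have "\<not> elts y \<lesssim> univ N" using N'(4) lepoll_trans2 by blast
  moreover have "univ M \<lesssim> univ N"
    using e unfolding embedding_def lepoll_def by blast
  ultimately show ?thesis by blast
qed

text \<open>If the unextendable models of \<open>\<phi>\<close> were unbounded in size, a maximal family of them in which
  any two differ in size so much that one cannot be extended to the size of the other
  would be a proper class without elementary embeddings.\<close>

lemma (in logic) unextendable_bounded:
  assumes VP: "Vopenka_Principle TYPE('v)" and \<sigma>: "language \<sigma>"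
  shows "\<exists>x::'v. \<forall>M y. lang M = \<sigma> \<longrightarrow> unextendable Sat \<phi> M y \<longrightarrow> \<not> elts x \<lesssim> univ M"
proof (rule ccontr)
  assume "\<not> ?thesis"
  then have unbounded: "\<exists>M y. lang M = \<sigma> \<and> unextendable Sat \<phi> M y \<and> elts x \<lesssim> univ M" for x :: 'v
    by blast
  define B where "B = {M. lang M = \<sigma> \<and> (\<exists>y. unextendable Sat \<phi> M y)}"
  define Y where "Y M = (SOME y. unextendable Sat \<phi> M y)" for M
  have Y: "unextendable Sat \<phi> M (Y M)" if "M \<in> B" for M
    using that unfolding B_def Y_def by (auto intro: someI)
  \<comment> \<open>One of the two structures reaches the size forbidden for extensions of the
    other; the relation is symmetric, as Vopenka's Principle does not say which of two structures
    embeds.\<close>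
  define sep where "sep M N \<longleftrightarrow> elts (Y M) \<lesssim> univ N \<or> elts (Y N) \<lesssim> univ M" for M N
  define P where "P = {C. C \<subseteq> B \<and> (\<forall>M\<in>C. \<forall>N\<in>C. M \<noteq> N \<longrightarrow> sep M N)}"
  \<comment> \<open>Zorn's lemma replaces a transfinite choice of ever larger models. The families
    may be proper classes, which are ordinary sets over the type.\<close>
  have "\<exists>C\<in>P. \<forall>X\<in>P. C \<subseteq> X \<longrightarrow> X = C"
  proof (rule subset_Zorn')
    fix K assume K: "subset.chain P K"
    have "sep M N" if "M \<in> \<Union>K" "N \<in> \<Union>K" "M \<noteq> N" for M N
    proof -
      from that obtain C D where CD: "C \<in> K" "D \<in> K" "M \<in> C" "N \<in> D" by blast
      then have "C \<subseteq> D \<or> D \<subseteq> C" using K unfolding subset_chain_def by blast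
      then obtain E where "E \<in> K" "M \<in> E" "N \<in> E" using CD by blast
      then show ?thesis using K that(3) unfolding subset_chain_def P_def by blast
    qed
    moreover have "\<Union>K \<subseteq> B" using K unfolding subset_chain_def P_def by blast
    ultimately show "\<Union>K \<in> P" unfolding P_def by blast
  qed
  then obtain C where C: "C \<in> P" and max: "\<And>X. X \<in> P \<Longrightarrow> C \<subseteq> X \<Longrightarrow> X = C" by blast
  have CB: "C \<subseteq> B" and Csep: "\<And>M N. M \<in> C \<Longrightarrow> N \<in> C \<Longrightarrow> M \<noteq> N \<Longrightarrow> sep M N"
    using C unfolding P_def by blast+
  have "\<not> small TYPE('v) C"
  proof
    assume "small TYPE('v) C"
    \<comment> \<open>If \<open>C\<close> were small, some \<open>x\<close> would dominate all its
      forbidden sizes. An unextendable model of size at least \<open>x\<close> is separated from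
      every member, so by maximality it belongs to \<open>C\<close> and reaches its own forbidden
      size.\<close>
    then have "small TYPE('v) (\<Union>M\<in>C. elts (Y M))" by (intro small_UN) simp_all
    then obtain x where x: "elts x = (\<Union>M\<in>C. elts (Y M))" using small_vset by blast
    obtain M y where M: "lang M = \<sigma>" "unextendable Sat \<phi> M y" "elts x \<lesssim> univ M"
      using unbounded by blast
    have MB: "M \<in> B" using M unfolding B_def by blast
    have big: "elts (Y N) \<lesssim> univ M" if "N \<in> C" for N
      by (rule lepoll_trans [OF subset_imp_lepoll M(3)]) (use that x in blast)
    have "insert M C \<in> P"
      using C MB big unfolding P_def sep_def by blast
    then have "M \<in> C" using max [of "insert M C"] by blast
    then show False using big Y [OF MB] unextendable_not_lepoll by blast
  qed
  moreover have "\<forall>M\<in>C. is_structure_of \<sigma> M"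
    using CB Y unfolding B_def is_structure_of_def unextendable_def by blast
  ultimately obtain M N j where MN: "M \<in> C" "N \<in> C" "M \<noteq> N" "elementary_embedding j M N"
    using VP \<sigma> unfolding Vopenka_Principle_def by blast
  have YM: "unextendable Sat \<phi> M (Y M)" and YN: "unextendable Sat \<phi> N (Y N)"
    using MN CB Y by blast+
  \<comment> \<open>The embedding rules out that \<open>N\<close> reaches the size forbidden for
    \<open>M\<close>. Separation then makes \<open>M\<close>, and with it \<open>N\<close>, reach
    the size forbidden for \<open>N\<close>, which is impossible.\<close>
  have *: "univ M \<lesssim> univ N" "\<not> elts (Y M) \<lesssim> univ N"
    using embedding_into_model [OF YM _ MN(4)] YN unfolding unextendable_def by blast+
  then have "elts (Y N) \<lesssim> univ M" using Csep [OF MN(1-3)] unfolding sep_def by blast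
  then have "elts (Y N) \<lesssim> univ N" using *(1) lepoll_trans by blast
  then show False using YN unextendable_not_lepoll by blast
qed

section \<open>Renaming small languages into one fixed set of symbols\<close>

fun sym_name :: "'v symbol \<Rightarrow> 'v" where
  "sym_name (RelSym n x) = x"
| "sym_name (FunSym n x) = x"

fun set_name :: "'v symbol \<Rightarrow> 'v \<Rightarrow> 'v symbol" where
  "set_name (RelSym n x) y = RelSym n y"
| "set_name (FunSym n x) y = FunSym n y"

lemma set_name_simps [simp]:
  "is_Rel (set_name s y) = is_Rel s" "arity (set_name s y) = arity s"
  "sym_name (set_name s y) = y"
  by (cases s; simp)+

text \<open>A symbol is determined by kind, arity and name, and kind and arity offer only countably
  many possibilities.\<close>

lemma language_names: "language {s. sym_name s \<in> elts (\<mu>::'v::zfc)}"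
proof -
  have "inj_on (\<lambda>s. ((if is_Rel s then 0 else 1 :: nat, arity s), sym_name s))
      {s::'v symbol. sym_name s \<in> elts \<mu>}"
    (is "inj_on ?g ?A")
  proof (rule inj_onI)
    fix s t :: "'v symbol" assume "?g s = ?g t"
    then show "s = t" by (cases s; cases t) auto
  qed
  moreover have "?g ` ?A \<subseteq> (UNIV \<times> UNIV) \<times> elts \<mu>" by auto
  ultimately have "?A \<lesssim> ((UNIV :: nat set) \<times> (UNIV :: nat set)) \<times> elts \<mu>"
    unfolding lepoll_def by blast
  then show ?thesis
    unfolding language_def
    by (rule small_lepoll) (intro small_Times small_UNIV_nat small_elts)
qed

text \<open>Only names are changed, so kind and arity are kept; distinct new names already make the
  renaming injective.\<close>

lemma renaming_into_names:
  assumes "\<tau> \<lesssim> elts \<mu>"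
  obtains f where "renaming f \<tau> (f ` \<tau>)" "f ` \<tau> \<subseteq> {s. sym_name s \<in> elts \<mu>}"
proof -
  obtain h where h: "inj_on h \<tau>" "h ` \<tau> \<subseteq> elts \<mu>" using assms unfolding lepoll_def by blast
  define f where "f s = set_name s (h s)" for s
  have "inj_on f \<tau>"
  proof (rule inj_onI)
    fix s t assume st: "s \<in> \<tau>" "t \<in> \<tau>" and "f s = f t"
    from \<open>f s = f t\<close> have "sym_name (f s) = sym_name (f t)" by simp
    then have "h s = h t" by (simp add: f_def)
    then show "s = t" using inj_onD [OF h(1)] st by blast
  qed
  then show thesis
    using h(2) by (intro that [of f]) (auto simp: renaming_def bij_betw_def f_def)
qed

lemma language_subset: "\<tau> \<subseteq> \<sigma> \<Longrightarrow> language \<sigma> \<Longrightarrow> language \<tau>"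
  unfolding language_def by (rule small_subset)

lemma is_structure_of_reduct:
  fixes M :: "'v::zfc struct"
  assumes M: "is_structure_of \<sigma> M" and "\<tau> \<subseteq> \<sigma>"
  shows "is_structure_of \<tau> (reduct \<tau> M)"
proof -
  have sM: "is_struct M" "lang M = \<sigma>" using M by (auto simp: is_structure_of_def)
  then have "language \<tau>" "univ M \<noteq> {}" "small TYPE('v) (univ M)"
    using assms(2) language_subset unfolding is_struct_def by blast+
  moreover note is_structD [OF sM(1), unfolded sM(2)]
  ultimately show ?thesis
    using assms(2) by (simp add: is_structure_of_def is_struct_def reduct_def subset_iff)
qed

text \<open>A model is cut down to the few symbols its sentence uses and renamed into
  \<open>\<Sigma>\<close>; it is extended there, and the extension is pulled back to the original
  language.\<close>

lemma (in logic) Vopenka_imp_ULST: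
  assumes VP: "Vopenka_Principle TYPE('v)"
  shows "\<exists>\<delta>. is_ULST Sen Sat \<delta>"
proof -
  obtain \<mu> :: 'v where \<mu>: "\<And>\<tau> \<phi>. language \<tau> \<Longrightarrow> \<phi> \<in> Sen \<tau> \<Longrightarrow> \<exists>\<tau>'\<subseteq>\<tau>. \<tau>' \<prec> elts \<mu> \<and> \<phi> \<in> Sen \<tau>'"
    using occurrence_number by blast
  define \<Sigma> where "\<Sigma> = {s. sym_name s \<in> elts \<mu>}"
  have \<Sigma>: "language \<Sigma>" unfolding \<Sigma>_def by (rule language_names)
  have "\<forall>\<sigma> \<phi>. \<exists>x::'v. language \<sigma> \<longrightarrow>
      (\<forall>M y. lang M = \<sigma> \<longrightarrow> unextendable Sat \<phi> M y \<longrightarrow> \<not> elts x \<lesssim> univ M)"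
    using unextendable_bounded [OF VP] by blast
  then obtain X :: "'v language \<Rightarrow> 'v \<Rightarrow> 'v" where X: "\<And>\<sigma> \<phi> M y. language \<sigma> \<Longrightarrow> lang M = \<sigma> \<Longrightarrow> unextendable Sat \<phi> M y \<Longrightarrow>
      \<not> elts (X \<sigma> \<phi>) \<lesssim> univ M"
    by metis
  \<comment> \<open>The cardinal \<open>\<delta>\<close> is the size of the union of the bounds for
    all sublanguages of \<open>\<Sigma>\<close> and all their sentences, hence at least as large as
    each of them.\<close>
  have "small TYPE('v) (\<Union>\<sigma>\<in>Pow \<Sigma>. \<Union>\<phi>\<in>Sen \<sigma>. elts (X \<sigma> \<phi>))"
    using \<Sigma> language_subset
    by (intro small_UN small_Pow small_Sen small_elts) (auto simp: language_def)
  then obtain \<delta> :: 'v where \<delta>: "cardinal \<delta>"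
      "elts \<delta> \<approx> (\<Union>\<sigma>\<in>Pow \<Sigma>. \<Union>\<phi>\<in>Sen \<sigma>. elts (X \<sigma> \<phi>))"
    using small_eqpoll_cardinal by blast
  have "ULST_property Sen Sat \<delta>"
    unfolding ULST_property_def
  proof (intro allI impI)
    fix \<tau> \<phi> M \<gamma> \<gamma>'
    assume \<tau>: "language \<tau>" and \<phi>: "\<phi> \<in> Sen \<tau>" and M: "is_structure_of \<tau> M" and sat: "Sat M \<phi>"
      and \<gamma>: "univ M \<approx> elts \<gamma>" "elts \<delta> \<subseteq> elts \<gamma>"
    obtain \<tau>' where \<tau>': "\<tau>' \<subseteq> \<tau>" "\<tau>' \<prec> elts \<mu>" "\<phi> \<in> Sen \<tau>'" using \<mu> [OF \<tau> \<phi>] by blast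
    obtain f where f: "renaming f \<tau>' (f ` \<tau>')" "f ` \<tau>' \<subseteq> \<Sigma>"
      using renaming_into_names [OF lesspoll_imp_lepoll [OF \<tau>'(2)]] unfolding \<Sigma>_def by blast
    have lang: "language \<tau>'" "language (f ` \<tau>')"
      using \<tau>'(1) f(2) \<tau> \<Sigma> language_subset by blast+
    obtain g where g: "bij_betw g (Sen \<tau>') (Sen (f ` \<tau>'))"
      and g_sat: "\<And>M \<phi>. is_structure_of \<tau>' M \<Longrightarrow> \<phi> \<in> Sen \<tau>' \<Longrightarrow>
        Sat M \<phi> \<longleftrightarrow> Sat (rename f M) (g \<phi>)"
      using Sat_renaming [OF lang f(1)] by blast
    define M' where "M' = rename f (reduct \<tau>' M)"
    have red: "is_structure_of \<tau>' (reduct \<tau>' M)" by (rule is_structure_of_reduct [OF M \<tau>'(1)])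
    have "Sat (reduct \<tau>' M) \<phi>" using Sat_reduct [OF M \<tau>'(1,3)] sat by blast
    then have sat': "Sat M' (g \<phi>)" unfolding M'_def using g_sat [OF red \<tau>'(3)] by blast
    have sM': "is_struct M'" using Sat_dom [OF sat'] by blast
    have M': "lang M' = f ` \<tau>'" "univ M' = univ M"
      by (simp_all add: M'_def rename_def reduct_def)
    have g\<phi>: "g \<phi> \<in> Sen (f ` \<tau>')" using g \<tau>'(3) by (auto simp: bij_betw_def)
    \<comment> \<open>The renamed model is at least as large as the bound for its sentence, so it
      cannot be unextendable.\<close>
    have "elts (X (f ` \<tau>') (g \<phi>)) \<lesssim> elts \<delta>"
      using \<delta>(2) g\<phi> f(2)
      by (intro lepoll_trans2 [OF subset_imp_lepoll eqpoll_sym]) auto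
    also have "elts \<delta> \<lesssim> elts \<gamma>" by (rule subset_imp_lepoll [OF \<gamma>(2)])
    also have "elts \<gamma> \<approx> univ M'" using \<gamma>(1) M'(2) by (simp add: eqpoll_sym)
    finally have "\<not> unextendable Sat (g \<phi>) M' \<gamma>'" using X lang(2) M'(1) by blast
    then obtain N where N: "is_struct N" "elts \<gamma>' \<lesssim> univ N" "Sat N (g \<phi>)" "substructure M' N"
      using sM' sat' unfolding unextendable_def by blast
    have "is_structure_of (f ` \<tau>') N"
      using N M' by (simp add: is_structure_of_def substructure_def)
    then obtain N' where N': "is_structure_of \<tau> N'" "univ N' = univ N" "substructure M N'"
      "rename f (reduct \<tau>' N') = N"
      using expansion_along_renaming [OF M _ f(1) \<tau>'(1)] N(4) unfolding M'_def by blast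
    have "Sat (reduct \<tau>' N') \<phi>"
      using g_sat [OF is_structure_of_reduct [OF N'(1) \<tau>'(1)] \<tau>'(3)] N'(4) N(3) by simp
    then have "Sat N' \<phi>" using Sat_reduct [OF N'(1) \<tau>'(1,3)] by blast
    then show "\<exists>N. is_structure_of \<tau> N \<and> elts \<gamma>' \<lesssim> univ N \<and> Sat N \<phi> \<and> substructure M N"
      using N' N(2) by auto
  qed
  then show ?thesis using is_ULST_exists \<delta>(1) by blast
qed

section \<open>Morleyization\<close>

text \<open>Terms are stratified by size: each level consists of variables and of symbols applied to
  lists from the level below, and countably many levels exhaust all terms.\<close>

lemma small_wf_tm:
  fixes T :: "'v::zfc itself"
  assumes "small T \<tau>"
  shows "small T {t. wf_tm \<tau> t}"
proof -
  have *: "small T {t. wf_tm \<tau> t \<and> size t < n}" for n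
  proof (induction n)
    case 0
    then show ?case by (simp add: small_lepoll [OF _ small_UNIV_nat])
  next
    case (Suc n)
    have "{t. wf_tm \<tau> t \<and> size t < Suc n} \<subseteq>
        range Var \<union> (\<lambda>(s, ts). App s ts) ` (\<tau> \<times> lists {t. wf_tm \<tau> t \<and> size t < n})"
    proof
      fix t assume "t \<in> {t. wf_tm \<tau> t \<and> size t < Suc n}"
      then have t: "wf_tm \<tau> t" "size t < Suc n" by auto
      show "t \<in> range Var \<union> (\<lambda>(s, ts). App s ts) ` (\<tau> \<times> lists {t. wf_tm \<tau> t \<and> size t < n})"
      proof (cases t)
        case (App s ts)
        have "size u < n" if "u \<in> set ts" for u
          using size_list_estimation' [OF that order_refl, of size] t(2) App by simp
        then have "ts \<in> lists {t. wf_tm \<tau> t \<and> size t < n}" using t(1) App by auto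
        then show ?thesis using t(1) App by force
      qed simp
    qed
    then show ?case
      by (rule small_subset)
        (intro small_Un small_image small_UNIV_nat small_Times small_lists assms Suc)
  qed
  have "{t. wf_tm \<tau> t} = (\<Union>n. {t. wf_tm \<tau> t \<and> size t < n})" by auto
  also have "small T \<dots>" by (intro small_UN small_UNIV_nat *)
  finally show ?thesis .
qed

lemma small_wf_fm:
  fixes T :: "'v::zfc itself"
  assumes \<tau>: "small T \<tau>"
  shows "small T {p. wf_fm \<tau> p}"
proof -
  define W where "W = {t. wf_tm \<tau> t}"
  have W: "small T W" unfolding W_def by (rule small_wf_tm [OF \<tau>])
  have *: "small T {p. wf_fm \<tau> p \<and> size p < n}" for n
  proof (induction n)
    case 0
    then show ?case by (simp add: small_lepoll [OF _ small_UNIV_nat])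
  next
    case (Suc n)
    define F where "F = {p. wf_fm \<tau> p \<and> size p < n}"
    have "{p. wf_fm \<tau> p \<and> size p < Suc n} \<subseteq>
        (\<lambda>(t, u). Eq t u) ` (W \<times> W) \<union> (\<lambda>(s, ts). Atom s ts) ` (\<tau> \<times> lists W) \<union>
        Neg ` F \<union> (\<lambda>(p, q). Conj p q) ` (F \<times> F) \<union> (\<lambda>(n, p). Exi n p) ` (UNIV \<times> F)"
      (is "_ \<subseteq> ?R")
    proof
      fix p assume "p \<in> {p. wf_fm \<tau> p \<and> size p < Suc n}"
      then show "p \<in> ?R"
        by (cases p) (force simp: W_def F_def)+
    qed
    moreover have "small T F" unfolding F_def by (rule Suc)
    then have "small T ?R"
      by (intro small_Un small_image small_UNIV_nat small_Times small_lists \<tau> W)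
    ultimately show ?case by (rule small_subset)
  qed
  have "{p. wf_fm \<tau> p} = (\<Union>n. {p. wf_fm \<tau> p \<and> size p < n})" by auto
  also have "small T \<dots>" by (intro small_UN small_UNIV_nat *)
  finally show ?thesis .
qed

section \<open>Naming formulas by relation symbols\<close>

text \<open>A bound strictly above all variable indices, in general not the least: sums stand in for
  maxima. In \<open>fm_bound\<close> a quantifier does not lower it.\<close>

fun tm_bound :: "'v tm \<Rightarrow> nat" where
  "tm_bound (Var n) = Suc n"
| "tm_bound (App s ts) = sum_list (map tm_bound ts)"

fun fm_bound :: "'v fm \<Rightarrow> nat" where
  "fm_bound (Eq t u) = tm_bound t + tm_bound u"
| "fm_bound (Atom s ts) = sum_list (map tm_bound ts)"
| "fm_bound (Neg p) = fm_bound p"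
| "fm_bound (Conj p q) = fm_bound p + fm_bound q"
| "fm_bound (Exi n p) = fm_bound p"

lemma tm_bound_le: "t \<in> set ts \<Longrightarrow> tm_bound t \<le> sum_list (map tm_bound ts)"
  by (induction ts) auto

lemma tm_val_cong: "(\<And>i. i < tm_bound t \<Longrightarrow> e i = e' i) \<Longrightarrow> tm_val M e t = tm_val M e' t"
proof (induction t)
  case (App s ts)
  have "tm_val M e t = tm_val M e' t" if t: "t \<in> set ts" for t
  proof (rule App.IH [OF t])
    fix i assume "i < tm_bound t"
    then show "e i = e' i" using App.prems tm_bound_le [OF t] by simp
  qed
  then have "map (tm_val M e) ts = map (tm_val M e') ts" by simp
  then show ?case by (simp only: tm_val.simps)
qed simp

lemma fo_sat_cong: "(\<And>i. i < fm_bound p \<Longrightarrow> e i = e' i) \<Longrightarrow> fo_sat M e p \<longleftrightarrow> fo_sat M e' p"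
proof (induction p arbitrary: e e')
  case (Eq t u)
  then have "tm_val M e t = tm_val M e' t" "tm_val M e u = tm_val M e' u"
    by (auto intro!: tm_val_cong)
  then show ?case by simp
next
  case (Atom s ts)
  have "tm_val M e t = tm_val M e' t" if t: "t \<in> set ts" for t
  proof (rule tm_val_cong)
    fix i assume "i < tm_bound t"
    then show "e i = e' i" using Atom.prems tm_bound_le [OF t] by simp
  qed
  then have "map (tm_val M e) ts = map (tm_val M e') ts" by simp
  then show ?case by (simp only: fo_sat.simps)
next
  case (Neg p)
  have "fo_sat M e p \<longleftrightarrow> fo_sat M e' p" by (rule Neg.IH) (use Neg.prems in simp)
  then show ?case by simp
next
  case (Conj p q)
  have "fo_sat M e p \<longleftrightarrow> fo_sat M e' p" by (rule Conj.IH(1)) (use Conj.prems in simp)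
  moreover have "fo_sat M e q \<longleftrightarrow> fo_sat M e' q" by (rule Conj.IH(2)) (use Conj.prems in simp)
  ultimately show ?case by simp
next
  case (Exi n p)
  have "fo_sat M (e(n := a)) p \<longleftrightarrow> fo_sat M (e'(n := a)) p" for a
    by (rule Exi.IH) (use Exi.prems in simp)
  then show ?case by simp
qed

text \<open>The arity is the variable bound, so that a tuple of that length fixes the values of all
  free variables of \<open>p\<close>.\<close>

definition fm_symbol :: "('v fm \<Rightarrow> 'v) \<Rightarrow> 'v fm \<Rightarrow> 'v symbol" where
  "fm_symbol nm p = RelSym (fm_bound p) (nm p)"

definition morley_language :: "('v fm \<Rightarrow> 'v) \<Rightarrow> 'v language \<Rightarrow> 'v language" where
  "morley_language nm \<tau> = fm_symbol nm ` {p. wf_fm \<tau> p}"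

text \<open>The new language is purely relational; the old symbols survive only through the formulas
  that mention them. Quantifying over all \<open>e\<close> that continue the tuple is harmless,
  since the truth of \<open>p\<close> depends only on values below
  \<open>fm_bound p\<close>.\<close>

definition morleyization :: "('v fm \<Rightarrow> 'v) \<Rightarrow> 'v struct \<Rightarrow> 'v struct" where
  "morleyization nm M =
     \<lparr>lang = morley_language nm (lang M), univ = univ M,
      rel_of = (\<lambda>s. {xs \<in> tuples (univ M) (arity s). \<exists>p. wf_fm (lang M) p \<and> s = fm_symbol nm p \<and>
                      (\<forall>e. (\<forall>i<length xs. e i = xs ! i) \<longrightarrow> fo_sat M e p)}),
      fun_of = (\<lambda>s xs. undefined)\<rparr>"

lemma morleyization_simps [simp]:
  "lang (morleyization nm M) = morley_language nm (lang M)"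
  "univ (morleyization nm M) = univ M"
  by (simp_all add: morleyization_def)

lemma morley_language_relational: "s \<in> morley_language nm \<tau> \<Longrightarrow> is_Rel s"
  by (auto simp: morley_language_def fm_symbol_def)

lemma language_morley: "language \<tau> \<Longrightarrow> language (morley_language nm \<tau>)"
  unfolding language_def morley_language_def by (intro small_image small_wf_fm)

lemma rel_of_morleyization_tuples:
  "rel_of (morleyization nm M) s \<subseteq> tuples (univ M) (arity s)"
  by (auto simp: morleyization_def)

lemma is_struct_morleyization: "is_struct M \<Longrightarrow> is_struct (morleyization nm M)"
  unfolding is_struct_def
  using language_morley [of "lang M" nm]
  by (auto simp: morley_language_def morleyization_def fm_symbol_def)

lemma rel_of_morleyization:
  assumes nm: "inj_on nm {p. wf_fm (lang M) p}" and p: "wf_fm (lang M) p"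
    and e: "range e \<subseteq> univ M"
  shows "map e [0..<fm_bound p] \<in> rel_of (morleyization nm M) (fm_symbol nm p) \<longleftrightarrow> fo_sat M e p"
proof
  assume "fo_sat M e p"
  moreover have "fo_sat M e p \<longleftrightarrow> fo_sat M e' p" if "\<forall>i<fm_bound p. e' i = e i" for e'
    using that by (intro fo_sat_cong) simp
  ultimately show "map e [0..<fm_bound p] \<in> rel_of (morleyization nm M) (fm_symbol nm p)"
    using p e by (auto simp: morleyization_def tuples_def fm_symbol_def intro!: exI [of _ p])
next
  assume "map e [0..<fm_bound p] \<in> rel_of (morleyization nm M) (fm_symbol nm p)"
  then obtain q where q: "wf_fm (lang M) q" "fm_symbol nm p = fm_symbol nm q"
    and sat: "\<forall>e'. (\<forall>i<length (map e [0..<fm_bound p]). e' i = map e [0..<fm_bound p] ! i) \<longrightarrow>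
      fo_sat M e' q"
    unfolding morleyization_def by auto
  have "p = q" using q p nm by (auto simp: fm_symbol_def inj_on_def)
  then show "fo_sat M e p" using sat by simp
qed

text \<open>The relation named by \<open>p\<close> is the truth of \<open>p\<close>, so respecting
  the new relations is elementarity itself.\<close>

lemma morleyization_elementary_embedding:
  assumes nm: "inj_on nm {p. wf_fm (lang M) p}" and lang: "lang M = lang N"
    and j: "j ` univ M \<subseteq> univ N"
    and rel: "\<And>s xs. s \<in> morley_language nm (lang M) \<Longrightarrow> xs \<in> tuples (univ M) (arity s) \<Longrightarrow>
      xs \<in> rel_of (morleyization nm M) s \<longleftrightarrow> map j xs \<in> rel_of (morleyization nm N) s"
  shows "elementary_embedding j M N"
proof -
  have "fo_sat M e p \<longleftrightarrow> fo_sat N (j \<circ> e) p"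
    if p: "wf_fm (lang M) p" and e: "range e \<subseteq> univ M" for p e
  proof -
    have "map e [0..<fm_bound p] \<in> rel_of (morleyization nm M) (fm_symbol nm p) \<longleftrightarrow>
        map j (map e [0..<fm_bound p]) \<in> rel_of (morleyization nm N) (fm_symbol nm p)"
      using p e by (intro rel) (auto simp: morley_language_def tuples_def fm_symbol_def)
    also have "map j (map e [0..<fm_bound p]) = map (j \<circ> e) [0..<fm_bound p]" by simp
    finally show ?thesis
      using rel_of_morleyization [OF nm p e] rel_of_morleyization [of nm N p "j \<circ> e"]
        nm p e j lang by (simp add: image_subset_iff)
  qed
  then show ?thesis unfolding elementary_embedding_def using lang j by blast
qed

text \<open>Each member is coded by a copy of its Morleyization on a subset of
  \<open>elts x\<close>. Equal codes yield an elementary embedding, hence equal members, and the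
  possible codes form a small collection. A proper class without embeddings therefore has members of
  unbounded size.\<close>

lemma small_bounded_antichain:
  fixes C :: "'v::zfc struct set" and nm :: "'v fm \<Rightarrow> 'v"
  assumes \<tau>: "language \<tau>" and nm: "inj_on nm {p. wf_fm \<tau> p}"
    and C: "\<And>M. M \<in> C \<Longrightarrow> is_structure_of \<tau> M"
    and bounded: "\<And>M. M \<in> C \<Longrightarrow> univ M \<lesssim> elts (x::'v)"
    and antichain: "\<And>M N j. M \<in> C \<Longrightarrow> N \<in> C \<Longrightarrow> elementary_embedding j M N \<Longrightarrow> M = N"
  shows "small TYPE('v) C"
proof -
  have "\<forall>M\<in>C. \<exists>h. inj_on h (univ M) \<and> h ` univ M \<subseteq> elts x"
    using bounded unfolding lepoll_def by blast
  then obtain h where h: "\<forall>M\<in>C. inj_on (h M) (univ M) \<and> h M ` univ M \<subseteq> elts x"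
    by (rule bchoice [THEN exE])
  have lang: "lang M = \<tau>" if "M \<in> C" for M using C [OF that] by (simp add: is_structure_of_def)
  define \<rho> where "\<rho> = morley_language nm \<tau>"
  define R where "R M = (SIGMA s:\<rho>. map (h M) ` rel_of (morleyization nm M) s)" for M
  have R: "map (h M) xs \<in> map (h M) ` rel_of (morleyization nm M) s \<longleftrightarrow>
      xs \<in> rel_of (morleyization nm M) s"
    if M: "M \<in> C" and xs: "xs \<in> tuples (univ M) (arity s)" for M xs s
  proof
    assume "map (h M) xs \<in> map (h M) ` rel_of (morleyization nm M) s"
    then obtain ys where ys: "ys \<in> rel_of (morleyization nm M) s" "map (h M) xs = map (h M) ys"
      by blast
    have inj: "inj_on (h M) (univ M)" using h M by blast
    have "ys \<in> tuples (univ M) (arity s)" using ys(1) rel_of_morleyization_tuples by blast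
    then have "xs = ys"
      using map_inv_into_tuples [OF inj xs] map_inv_into_tuples [OF inj, of ys "arity s"] ys(2)
      by simp
    then show "xs \<in> rel_of (morleyization nm M) s" using ys(1) by simp
  qed simp
  have "inj_on (\<lambda>M. (h M ` univ M, R M)) C"
  proof (rule inj_onI)
    fix M N assume M: "M \<in> C" and N: "N \<in> C"
      and "(h M ` univ M, R M) = (h N ` univ N, R N)"
    then have eq: "h M ` univ M = h N ` univ N" "R M = R N" by simp_all
    \<comment> \<open>From \<open>M\<close> to the common copy inside \<open>elts x\<close>, then
      back into \<open>N\<close>.\<close>
    define j where "j = inv_into (univ N) (h N) \<circ> h M"
    have j: "j a \<in> univ N \<and> h N (j a) = h M a" if "a \<in> univ M" for a
    proof -
      have "h M a \<in> h N ` univ N" using that eq(1) by blast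
      then show ?thesis by (simp add: j_def inv_into_into f_inv_into_f)
    qed
    have "elementary_embedding j M N"
    proof (rule morleyization_elementary_embedding)
      show "inj_on nm {p. wf_fm (lang M) p}" "lang M = lang N"
        using nm lang M N by simp_all
      show "j ` univ M \<subseteq> univ N" using j by blast
    next
      fix s xs assume s: "s \<in> morley_language nm (lang M)" and xs: "xs \<in> tuples (univ M) (arity s)"
      have s\<rho>: "s \<in> \<rho>" using s lang M by (simp add: \<rho>_def)
      have jxs: "map j xs \<in> tuples (univ N) (arity s)"
        by (rule map_tuples [OF xs]) (use j in blast)
      have hj: "map (h N) (map j xs) = map (h M) xs"
        using xs j by (auto simp: tuples_def)
      have "xs \<in> rel_of (morleyization nm M) s \<longleftrightarrow> (s, map (h M) xs) \<in> R M"
        using R [OF M xs] s\<rho> by (simp add: R_def)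
      also have "\<dots> \<longleftrightarrow> (s, map (h N) (map j xs)) \<in> R N"
        by (simp only: eq(2) hj)
      also have "\<dots> \<longleftrightarrow> map j xs \<in> rel_of (morleyization nm N) s"
        using R [OF N jxs] s\<rho> by (simp only: R_def mem_Sigma_iff simp_thms)
      finally show "xs \<in> rel_of (morleyization nm M) s \<longleftrightarrow>
          map j xs \<in> rel_of (morleyization nm N) s" .
    qed
    then show "M = N" using antichain M N by blast
  qed
  moreover have "(\<lambda>M. (h M ` univ M, R M)) ` C \<subseteq> Pow (elts x) \<times> Pow (\<rho> \<times> lists (elts x))"
  proof (rule image_subsetI)
    fix M assume M: "M \<in> C"
    have sub: "h M ` univ M \<subseteq> elts x" using h M by blast
    have "map (h M) xs \<in> lists (elts x)" if "xs \<in> rel_of (morleyization nm M) s" for s xs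
    proof -
      have "set xs \<subseteq> univ M"
        using that rel_of_morleyization_tuples [of nm M s] by (auto simp: tuples_def)
      then show ?thesis using sub by (auto simp: subset_iff)
    qed
    then have "R M \<subseteq> \<rho> \<times> lists (elts x)" unfolding R_def by blast
    then show "(h M ` univ M, R M) \<in> Pow (elts x) \<times> Pow (\<rho> \<times> lists (elts x))"
      using sub by blast
  qed
  ultimately have "C \<lesssim> Pow (elts x) \<times> Pow (\<rho> \<times> lists (elts x))"
    unfolding lepoll_def by blast
  moreover have "small TYPE('v) \<rho>"
    using language_morley [OF \<tau>] by (simp add: \<rho>_def language_def)
  then have "small TYPE('v) (Pow (elts x) \<times> Pow (\<rho> \<times> lists (elts x)))"
    by (intro small_Times small_Pow small_lists small_elts)
  ultimately show ?thesis by (rule small_lepoll)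
qed

section \<open>The logic of a class of relational structures\<close>

text \<open>The type of all sets is infinite, hence equipollent to its square. The resulting
  injection plays the part of ordered pairs when renamings are coded as sets.\<close>

lemma symbol_pairs_lepoll: "(UNIV :: ('v::zfc symbol \<times> 'v symbol) set) \<lesssim> (UNIV :: 'v set)"
proof -
  define U where "U = (UNIV :: 'v set)"
  obtain i :: 'v where "infinite (elts i)" using infinite_set_exists by blast
  then have inf: "infinite U" unfolding U_def using finite_subset subset_UNIV by blast
  then have "U \<times> U \<approx> U"
    by (simp add: eqpoll_iff_card_of_ordIso card_of_Times_same_infinite)
  then have UU: "A \<times> B \<lesssim> U" if "A \<lesssim> U" "B \<lesssim> U" for A :: "'a set" and B :: "'b set"
    using lepoll_trans2 [OF times_lepoll_mono [OF that]] by blast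
  have nat: "(UNIV :: nat set) \<lesssim> U" using inf infinite_le_lepoll by blast
  define g :: "'v symbol \<Rightarrow> (nat \<times> nat) \<times> 'v"
    where "g s = ((if is_Rel s then 0 else 1, arity s), sym_name s)" for s
  have "inj g"
  proof (rule injI)
    fix s t assume "g s = g t"
    then show "s = t" by (cases s; cases t) (auto simp: g_def)
  qed
  then have "(UNIV :: 'v symbol set) \<lesssim> ((UNIV :: nat set) \<times> (UNIV :: nat set)) \<times> U"
    unfolding lepoll_def U_def by auto
  also have "\<dots> \<lesssim> U" by (intro lepoll_refl UU nat)
  finally have "(UNIV :: 'v symbol set) \<lesssim> U" .
  then have "(UNIV :: 'v symbol set) \<times> (UNIV :: 'v symbol set) \<lesssim> U" by (intro UU)
  then show ?thesis by (simp add: U_def)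
qed

lemma small_subsets: "small TYPE('v) {z::'v::zfc. elts z \<subseteq> elts x}"
proof -
  obtain p where "elts p = {z. elts z \<subseteq> elts x}" using powerset by blast
  then show ?thesis using small_elts by metis
qed

lemma is_struct_rename:
  fixes M :: "'v::zfc struct"
  assumes M: "is_struct M" and f: "renaming f (lang M) \<sigma>"
  shows "is_struct (rename f M)"
proof -
  have inj: "inj_on f (lang M)" using f by (simp add: renaming_def bij_betw_def)
  have f': "inv_into (lang M) f (f s) = s" "arity (f s) = arity s" "is_Rel (f s) \<longleftrightarrow> is_Rel s"
    "is_Fun (f s) \<longleftrightarrow> is_Fun s" if "s \<in> lang M" for s
  proof -
    show *: "is_Rel (f s) \<longleftrightarrow> is_Rel s" "arity (f s) = arity s"
      "inv_into (lang M) f (f s) = s"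
      using f that inj by (simp_all add: renaming_def)
    show "is_Fun (f s) \<longleftrightarrow> is_Fun s" using *(1) by (cases s; cases "f s") auto
  qed
  show ?thesis
    unfolding is_struct_def
  proof (intro conjI allI)
    show "language (lang (rename f M))" "small TYPE('v) (univ (rename f M))"
        "univ (rename f M) \<noteq> {}"
      using M small_image [of "TYPE('v)"] by (auto simp: is_struct_def rename_def language_def)
  next
    fix s :: "'v symbol"
    show "if s \<in> lang (rename f M) \<and> is_Rel s
        then rel_of (rename f M) s \<subseteq> tuples (univ (rename f M)) (arity s)
        else rel_of (rename f M) s = {}"
      using is_structD(1,2) [OF M] f' by (auto simp: rename_def subset_iff)
  next
    fix s :: "'v symbol" and xs
    show "if s \<in> lang (rename f M) \<and> is_Fun s \<and> xs \<in> tuples (univ (rename f M)) (arity s)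
        then fun_of (rename f M) s xs \<in> univ (rename f M)
        else fun_of (rename f M) s xs = undefined"
      using is_structD(3,4) [OF M] f' by (auto simp: rename_def)
  qed
qed

text \<open>Only the relations of \<open>M\<close> named by \<open>f\<close> on
  \<open>\<rho>\<close> are read, whatever else \<open>M\<close> interprets; invariance under
  reducts rests on this.\<close>

definition rel_iso_along ::
  "'v language \<Rightarrow> ('v symbol \<Rightarrow> 'v symbol) \<Rightarrow> 'v struct \<Rightarrow> 'v struct \<Rightarrow> bool" where
  "rel_iso_along \<rho> f M A \<longleftrightarrow>
     (\<exists>h. bij_betw h (univ M) (univ A) \<and>
        (\<forall>s\<in>\<rho>. \<forall>xs\<in>tuples (univ M) (arity s).
           xs \<in> rel_of M (f s) \<longleftrightarrow> map h xs \<in> rel_of A s))"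

lemma rel_iso_along_cong:
  assumes "univ M = univ N" "\<And>s. s \<in> \<rho> \<Longrightarrow> rel_of M (f s) = rel_of N (g s)"
  shows "rel_iso_along \<rho> f M A \<longleftrightarrow> rel_iso_along \<rho> g N A"
  unfolding rel_iso_along_def using assms by simp

lemma rel_iso_along_isomorphic:
  assumes iso: "isomorphic M N"
    and f: "\<And>s. s \<in> \<rho> \<Longrightarrow> f s \<in> lang M \<and> is_Rel (f s) \<and> arity (f s) = arity s"
  shows "rel_iso_along \<rho> f M A \<longleftrightarrow> rel_iso_along \<rho> f N A"
proof -
  obtain k where k: "bij_betw k (univ M) (univ N)"
    and "\<forall>s\<in>lang M. is_Rel s \<longrightarrow>
      (\<forall>xs\<in>tuples (univ M) (arity s). xs \<in> rel_of M s \<longleftrightarrow> map k xs \<in> rel_of N s)"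
    using iso unfolding isomorphic_def by blast
  then have k_rel: "xs \<in> rel_of M (f s) \<longleftrightarrow> map k xs \<in> rel_of N (f s)"
    if "s \<in> \<rho>" "xs \<in> tuples (univ M) (arity s)" for s xs
    using f [OF that(1)] that(2) by metis
  define k' where "k' = inv_into (univ M) k"
  have k': "bij_betw k' (univ N) (univ M)" unfolding k'_def by (rule bij_betw_inv_into [OF k])
  have kk': "k (k' y) = y" if "y \<in> univ N" for y
    unfolding k'_def using k that by (rule bij_betw_inv_into_right)
  show ?thesis
  proof
    assume "rel_iso_along \<rho> f M A"
    then obtain h where h: "bij_betw h (univ M) (univ A)"
      and h_rel: "\<And>s xs. s \<in> \<rho> \<Longrightarrow> xs \<in> tuples (univ M) (arity s) \<Longrightarrow>
        xs \<in> rel_of M (f s) \<longleftrightarrow> map h xs \<in> rel_of A s"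
      unfolding rel_iso_along_def by blast
    have "xs \<in> rel_of N (f s) \<longleftrightarrow> map (h \<circ> k') xs \<in> rel_of A s"
      if s: "s \<in> \<rho>" and xs: "xs \<in> tuples (univ N) (arity s)" for s xs
    proof -
      have xs': "map k' xs \<in> tuples (univ M) (arity s)"
        by (rule map_tuples [OF xs]) (simp add: bij_betw_imp_surj_on [OF k'])
      have "map k (map k' xs) = xs"
        using xs kk' by (auto intro!: map_idI simp: tuples_def subset_iff)
      then show ?thesis using k_rel [OF s xs'] h_rel [OF s xs'] by simp
    qed
    then show "rel_iso_along \<rho> f N A"
      unfolding rel_iso_along_def using bij_betw_trans [OF k' h] by blast
  next
    assume "rel_iso_along \<rho> f N A"
    then obtain h where h: "bij_betw h (univ N) (univ A)"
      and h_rel: "\<And>s xs. s \<in> \<rho> \<Longrightarrow> xs \<in> tuples (univ N) (arity s) \<Longrightarrow>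
        xs \<in> rel_of N (f s) \<longleftrightarrow> map h xs \<in> rel_of A s"
      unfolding rel_iso_along_def by blast
    have "xs \<in> rel_of M (f s) \<longleftrightarrow> map (h \<circ> k) xs \<in> rel_of A s"
      if s: "s \<in> \<rho>" and xs: "xs \<in> tuples (univ M) (arity s)" for s xs
    proof -
      have xs': "map k xs \<in> tuples (univ N) (arity s)"
        by (rule map_tuples [OF xs]) (simp add: bij_betw_imp_surj_on [OF k])
      then show ?thesis using k_rel [OF s xs] h_rel [OF s xs'] by simp
    qed
    then show "rel_iso_along \<rho> f M A"
      unfolding rel_iso_along_def using bij_betw_trans [OF k h] by blast
  qed
qed

text \<open>The sentences are (codes of) renamings of \<open>\<rho>\<close>: a structure satisfies \<open>f\<close> if, read as a
  \<open>\<rho>\<close>-structure along \<open>f\<close>, it is isomorphic to a member of \<open>D\<close>.\<close>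

locale relational_class =
  fixes \<rho> :: "'v::zfc language" and D :: "'v struct set" and c :: "'v symbol \<times> 'v symbol \<Rightarrow> 'v"
  assumes language_\<rho>: "language \<rho>"
    and relational: "\<And>s. s \<in> \<rho> \<Longrightarrow> is_Rel s"
    and inj_c: "inj c"
begin

text \<open>The graph of \<open>f\<close> on \<open>\<rho>\<close>, with \<open>c\<close> as
  pairing: sentences have to be sets, and functions that agree on \<open>\<rho>\<close> must give
  the same sentence.\<close>

definition code :: "('v symbol \<Rightarrow> 'v symbol) \<Rightarrow> 'v" where
  "code f = (SOME z. elts z = (\<lambda>s. c (s, f s)) ` \<rho>)"

definition CSen :: "'v language \<Rightarrow> 'v set" where
  "CSen \<sigma> = {code f | f. renaming f \<rho> (f ` \<rho>) \<and> f ` \<rho> \<subseteq> \<sigma>}"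

definition CSat :: "'v struct \<Rightarrow> 'v \<Rightarrow> bool" where
  "CSat M \<phi> \<longleftrightarrow> is_struct M \<and>
     (\<exists>f. renaming f \<rho> (f ` \<rho>) \<and> f ` \<rho> \<subseteq> lang M \<and> \<phi> = code f \<and> (\<exists>A\<in>D. rel_iso_along \<rho> f M A))"

lemma elts_code: "elts (code f) = (\<lambda>s. c (s, f s)) ` \<rho>"
proof -
  have "\<exists>z. elts z = (\<lambda>s. c (s, f s)) ` \<rho>"
    using language_\<rho> unfolding language_def by (intro small_vset small_image)
  then show ?thesis unfolding code_def by (rule someI_ex)
qed

lemma code_eq_iff: "code f = code g \<longleftrightarrow> (\<forall>s\<in>\<rho>. f s = g s)"
proof
  assume eq: "code f = code g"
  show "\<forall>s\<in>\<rho>. f s = g s"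
  proof
    fix s assume "s \<in> \<rho>"
    then have "c (s, f s) \<in> (\<lambda>s. c (s, g s)) ` \<rho>" using elts_code [of f] elts_code [of g] eq by auto
    then obtain t where "c (s, f s) = c (t, g t)" by blast
    then have "(s, f s) = (t, g t)" by (rule injD [OF inj_c])
    then show "f s = g s" by blast
  qed
next
  assume "\<forall>s\<in>\<rho>. f s = g s"
  then have "elts (code f) = elts (code g)" by (simp add: elts_code cong: image_cong)
  then show "code f = code g" by (rule extensionality)
qed

lemma CSat_code:
  assumes "is_struct M" "renaming f \<rho> (f ` \<rho>)" "f ` \<rho> \<subseteq> lang M"
  shows "CSat M (code f) \<longleftrightarrow> (\<exists>A\<in>D. rel_iso_along \<rho> f M A)"
proof
  assume "CSat M (code f)"
  then obtain g A where "code f = code g" "A \<in> D" "rel_iso_along \<rho> g M A"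
    unfolding CSat_def by blast
  then show "\<exists>A\<in>D. rel_iso_along \<rho> f M A"
    using rel_iso_along_cong [of M M \<rho> f g A] by (auto simp: code_eq_iff)
qed (use assms in \<open>auto simp: CSat_def\<close>)

lemma CSen_cases:
  assumes "\<phi> \<in> CSen \<sigma>"
  obtains f where "\<phi> = code f" "renaming f \<rho> (f ` \<rho>)" "f ` \<rho> \<subseteq> \<sigma>"
    "\<And>s. s \<in> \<rho> \<Longrightarrow> f s \<in> \<sigma> \<and> is_Rel (f s) \<and> arity (f s) = arity s"
proof -
  obtain f where f: "\<phi> = code f" "renaming f \<rho> (f ` \<rho>)" "f ` \<rho> \<subseteq> \<sigma>"
    using assms unfolding CSen_def by blast
  moreover have "f s \<in> \<sigma> \<and> is_Rel (f s) \<and> arity (f s) = arity s" if "s \<in> \<rho>" for s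
    using f that relational unfolding renaming_def by blast
  ultimately show thesis by (rule that)
qed

text \<open>A renaming of languages acts on sentences by composition after the coded renaming;
  inverting it on \<open>\<tau>\<close> gives surjectivity.\<close>

lemma CSen_renaming:
  assumes h: "renaming h \<tau> \<sigma>"
  obtains g where "bij_betw g (CSen \<tau>) (CSen \<sigma>)"
    "\<And>f. f ` \<rho> \<subseteq> \<tau> \<Longrightarrow> renaming f \<rho> (f ` \<rho>) \<Longrightarrow> g (code f) = code (h \<circ> f)"
proof -
  \<comment> \<open>Decoding by choice. The chosen representative may differ from \<open>f\<close>
    outside \<open>\<rho>\<close>, which the code of the composite does not see.\<close>
  define F where "F \<phi> = (SOME f. \<phi> = code f)" for \<phi>
  define g where "g \<phi> = code (h \<circ> F \<phi>)" for \<phi>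
  have "code f = code (F (code f))" for f
    unfolding F_def by (rule someI [of _ f]) (rule refl)
  then have g: "g (code f) = code (h \<circ> f)" for f
    unfolding g_def by (simp add: code_eq_iff)
  have inj: "inj_on h \<tau>" and img: "h ` \<tau> = \<sigma>" using h by (auto simp: renaming_def bij_betw_def)
  have h_sym: "is_Rel (h s) = is_Rel s \<and> arity (h s) = arity s" if "s \<in> \<tau>" for s
    using h that by (simp add: renaming_def)
  have "inj_on g (CSen \<tau>)"
  proof (rule inj_onI)
    fix \<phi> \<psi> assume "\<phi> \<in> CSen \<tau>" "\<psi> \<in> CSen \<tau>" and eq: "g \<phi> = g \<psi>"
    then obtain f f' where f: "\<phi> = code f" "f ` \<rho> \<subseteq> \<tau>" and f': "\<psi> = code f'" "f' ` \<rho> \<subseteq> \<tau>"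
      by (meson CSen_cases)
    have "\<forall>s\<in>\<rho>. h (f s) = h (f' s)" using eq f f' by (simp add: g code_eq_iff)
    then have "\<forall>s\<in>\<rho>. f s = f' s" using f(2) f'(2) inj by (auto dest: inj_onD)
    then show "\<phi> = \<psi>" using f f' by (simp add: code_eq_iff)
  qed
  moreover have "g ` CSen \<tau> = CSen \<sigma>"
  proof (intro equalityI subsetI)
    fix \<psi> assume "\<psi> \<in> g ` CSen \<tau>"
    then obtain \<phi> where "\<phi> \<in> CSen \<tau>" "\<psi> = g \<phi>" by blast
    then obtain f where f: "\<psi> = code (h \<circ> f)" "renaming f \<rho> (f ` \<rho>)" "f ` \<rho> \<subseteq> \<tau>"
      using g by (metis CSen_cases)
    have "inj_on (h \<circ> f) \<rho>"
      using f inj by (intro comp_inj_on) (auto simp: renaming_def bij_betw_def intro: inj_on_subset)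
    then have "renaming (h \<circ> f) \<rho> ((h \<circ> f) ` \<rho>)"
      using f h_sym by (auto simp: renaming_def bij_betw_def)
    moreover have "(h \<circ> f) ` \<rho> \<subseteq> \<sigma>" using f img by auto
    ultimately show "\<psi> \<in> CSen \<sigma>" using f(1) unfolding CSen_def by blast
  next
    fix \<psi> assume "\<psi> \<in> CSen \<sigma>"
    then obtain f where f: "\<psi> = code f" "renaming f \<rho> (f ` \<rho>)" "f ` \<rho> \<subseteq> \<sigma>"
      by (rule CSen_cases)
    define f' where "f' = inv_into \<tau> h \<circ> f"
    have f': "f' s \<in> \<tau> \<and> h (f' s) = f s" if "s \<in> \<rho>" for s
    proof -
      have "f s \<in> h ` \<tau>" using that f(3) img by blast
      then show ?thesis by (simp add: f'_def inv_into_into f_inv_into_f)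
    qed
    have f_inj: "inj_on f \<rho>" using f(2) by (simp add: renaming_def bij_betw_def)
    have "inj_on f' \<rho>"
    proof (rule inj_onI)
      fix s t assume st: "s \<in> \<rho>" "t \<in> \<rho>" "f' s = f' t"
      then have "f s = f t" using f' by metis
      then show "s = t" using inj_onD [OF f_inj] st by blast
    qed
    moreover have "is_Rel (f' s) = is_Rel s \<and> arity (f' s) = arity s" if "s \<in> \<rho>" for s
      using f' [OF that] h_sym [of "f' s"] f(2) that by (simp add: renaming_def)
    ultimately have "renaming f' \<rho> (f' ` \<rho>)" by (simp add: renaming_def bij_betw_def)
    moreover have "f' ` \<rho> \<subseteq> \<tau>" using f' by blast
    ultimately have "code f' \<in> CSen \<tau>" unfolding CSen_def by blast
    moreover have "g (code f') = \<psi>" using f' f(1) by (simp add: g code_eq_iff)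
    ultimately show "\<psi> \<in> g ` CSen \<tau>" by blast
  qed
  ultimately show thesis using that [of g] g by (simp add: bij_betw_def)
qed

lemma logic: "logic CSen CSat"
proof
  fix \<sigma> :: "'v language" assume \<sigma>: "language \<sigma>"
  \<comment> \<open>All codes of renamings into \<open>\<sigma>\<close> are subsets of this one set,
    so the sentences lie in its power set.\<close>
  obtain y where y: "elts y = c ` (\<rho> \<times> \<sigma>)"
    using small_vset [OF small_image [OF small_Times]] language_\<rho> \<sigma> unfolding language_def by blast
  have "CSen \<sigma> \<subseteq> {z. elts z \<subseteq> elts y}"
    unfolding CSen_def y by (auto simp: elts_code image_subset_iff)
  then show "small TYPE('v) (CSen \<sigma>)" by (rule small_subset) (rule small_subsets)
next
  fix M \<phi> assume "CSat M \<phi>"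
  then show "is_struct M \<and> \<phi> \<in> CSen (lang M)" unfolding CSat_def CSen_def by blast
next
  fix \<sigma> \<tau> :: "'v language" assume "\<tau> \<subseteq> \<sigma>"
  then show "CSen \<tau> \<subseteq> CSen \<sigma>" unfolding CSen_def by blast
next
  fix \<sigma> \<tau> M \<phi> assume M: "is_structure_of \<sigma> M" and \<tau>: "\<tau> \<subseteq> \<sigma>" and \<phi>: "\<phi> \<in> CSen \<tau>"
  obtain f where f: "\<phi> = code f" "renaming f \<rho> (f ` \<rho>)" "f ` \<rho> \<subseteq> \<tau>" using \<phi> by (rule CSen_cases)
  have red: "is_structure_of \<tau> (reduct \<tau> M)" by (rule is_structure_of_reduct [OF M \<tau>])
  have "rel_iso_along \<rho> f M A \<longleftrightarrow> rel_iso_along \<rho> f (reduct \<tau> M) A" for A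
    using f(3) by (intro rel_iso_along_cong) (auto simp: reduct_def)
  then show "CSat M \<phi> \<longleftrightarrow> CSat (reduct \<tau> M) \<phi>"
    using CSat_code [of M f] CSat_code [of "reduct \<tau> M" f] M red f \<tau>
    by (simp add: is_structure_of_def)
next
  fix M N \<phi> assume MN: "is_struct M" "is_struct N" and iso: "isomorphic M N" and \<phi>: "\<phi> \<in> CSen (lang M)"
  obtain f where f: "\<phi> = code f" "renaming f \<rho> (f ` \<rho>)" "f ` \<rho> \<subseteq> lang M"
    "\<And>s. s \<in> \<rho> \<Longrightarrow> f s \<in> lang M \<and> is_Rel (f s) \<and> arity (f s) = arity s"
    using \<phi> by (rule CSen_cases) blast
  have "lang M = lang N" using iso by (simp add: isomorphic_def)
  then show "CSat M \<phi> \<longleftrightarrow> CSat N \<phi>"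
    using CSat_code [of M f] CSat_code [of N f] MN f rel_iso_along_isomorphic [OF iso f(4)] by simp
next
  fix \<tau> \<sigma> :: "'v language" and h assume h: "renaming h \<tau> \<sigma>"
  obtain g where g: "bij_betw g (CSen \<tau>) (CSen \<sigma>)"
    "\<And>f. f ` \<rho> \<subseteq> \<tau> \<Longrightarrow> renaming f \<rho> (f ` \<rho>) \<Longrightarrow> g (code f) = code (h \<circ> f)"
    by (rule CSen_renaming [OF h]) blast
  have inj: "inj_on h \<tau>" using h by (simp add: renaming_def bij_betw_def)
  have "CSat M \<phi> \<longleftrightarrow> CSat (rename h M) (g \<phi>)" if M: "is_structure_of \<tau> M" and \<phi>: "\<phi> \<in> CSen \<tau>" for M \<phi>
  proof -
    obtain f where f: "\<phi> = code f" "renaming f \<rho> (f ` \<rho>)" "f ` \<rho> \<subseteq> \<tau>" using \<phi> by (rule CSen_cases)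
    have sM: "is_struct M" "lang M = \<tau>" using M by (auto simp: is_structure_of_def)
    have g\<phi>: "g \<phi> = code (h \<circ> f)" using g(2) f by simp
    have "inj_on (h \<circ> f) \<rho>"
      using f inj by (intro comp_inj_on) (auto simp: renaming_def bij_betw_def intro: inj_on_subset)
    then have hf: "renaming (h \<circ> f) \<rho> ((h \<circ> f) ` \<rho>)"
      using f h by (auto simp: renaming_def bij_betw_def)
    have "is_struct (rename h M)" using is_struct_rename [OF sM(1)] sM(2) h by blast
    moreover have "(h \<circ> f) ` \<rho> \<subseteq> lang (rename h M)" using f sM by (auto simp: rename_def)
    moreover have "rel_iso_along \<rho> f M A \<longleftrightarrow> rel_iso_along \<rho> (h \<circ> f) (rename h M) A" for A
    proof (rule rel_iso_along_cong)
      fix s assume "s \<in> \<rho>"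
      then have "f s \<in> \<tau>" using f(3) by blast
      then show "rel_of M (f s) = rel_of (rename h M) ((h \<circ> f) s)"
        using inj sM(2) by (simp add: rename_def)
    qed (simp add: rename_def)
    ultimately show ?thesis
      using CSat_code [of M f] CSat_code [of "rename h M" "h \<circ> f"] sM f hf g\<phi> by simp
  qed
  then show "\<exists>g. bij_betw g (CSen \<tau>) (CSen \<sigma>) \<and>
      (\<forall>M \<phi>. is_structure_of \<tau> M \<longrightarrow> \<phi> \<in> CSen \<tau> \<longrightarrow> CSat M \<phi> = CSat (rename h M) (g \<phi>))"
    using g(1) by blast
next
  \<comment> \<open>A sentence uses exactly the symbols in the image of \<open>\<rho>\<close>, so
    any cardinal above the size of \<open>\<rho>\<close> is an occurrence number.\<close>
  obtain \<mu> :: 'v where \<mu>: "cardinal \<mu>" "\<rho> \<prec> elts \<mu>"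
    using larger_cardinal language_\<rho> unfolding language_def by blast
  have "\<exists>\<tau>'\<subseteq>\<tau>. \<tau>' \<prec> elts \<mu> \<and> \<phi> \<in> CSen \<tau>'" if "\<phi> \<in> CSen \<tau>" for \<tau> \<phi>
  proof -
    obtain f where f: "\<phi> = code f" "renaming f \<rho> (f ` \<rho>)" "f ` \<rho> \<subseteq> \<tau>"
      using \<open>\<phi> \<in> CSen \<tau>\<close> by (rule CSen_cases)
    have "f ` \<rho> \<prec> elts \<mu>" by (rule lesspoll_trans1 [OF image_lepoll \<mu>(2)])
    moreover have "\<phi> \<in> CSen (f ` \<rho>)" using f unfolding CSen_def by blast
    ultimately show ?thesis using f(3) by blast
  qed
  then show "\<exists>\<mu>::'v. cardinal \<mu> \<and>
      (\<forall>\<tau>. language \<tau> \<longrightarrow> (\<forall>\<phi>\<in>CSen \<tau>. \<exists>\<tau>'\<subseteq>\<tau>. \<tau>' \<prec> elts \<mu> \<and> \<phi> \<in> CSen \<tau>'))"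
    using \<mu>(1) by blast
qed

lemma renaming_id: "renaming id \<rho> (id ` \<rho>)"
  by (simp add: renaming_def)

lemma CSat_code_id_self: "A \<in> D \<Longrightarrow> is_structure_of \<rho> A \<Longrightarrow> CSat A (code id)"
  using CSat_code [OF _ renaming_id, of A]
  by (auto simp: is_structure_of_def rel_iso_along_def intro!: bexI [of _ A] exI [of _ id])

lemma code_id_sentence: "code id \<in> CSen \<rho>"
  unfolding CSen_def using renaming_id by fastforce

end

section \<open>From ULST numbers to Vopenka's Principle\<close>

lemma ULST_imp_Vopenka:
  assumes ULST: "\<And>(Sen :: 'v::zfc language \<Rightarrow> 'v set) Sat. logic Sen Sat \<Longrightarrow> \<exists>\<delta>. is_ULST Sen Sat \<delta>"
  shows "Vopenka_Principle TYPE('v)"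
proof (rule ccontr)
  assume "\<not> ?thesis"
  then obtain \<tau> :: "'v language" and C where \<tau>: "language \<tau>"
    and structures: "\<forall>M\<in>C. is_structure_of \<tau> M" and large: "\<not> small TYPE('v) C"
    and no_embedding: "\<not> (\<exists>M\<in>C. \<exists>N\<in>C. M \<noteq> N \<and> (\<exists>j. elementary_embedding j M N))"
    unfolding Vopenka_Principle_def by metis
  have C: "is_structure_of \<tau> M" if "M \<in> C" for M using structures that by blast
  have antichain: "M = N" if "M \<in> C" "N \<in> C" "elementary_embedding j M N" for M N j
    using no_embedding that by blast
  obtain x :: 'v where "{p. wf_fm \<tau> p} \<lesssim> elts x"
    using small_wf_fm \<tau> unfolding language_def small_def by blast
  \<comment> \<open>The well-formed formulas over a set-sized language form a small collection, so
    they can be named injectively by sets.\<close>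
  then obtain nm :: "'v fm \<Rightarrow> 'v" where nm: "inj_on nm {p. wf_fm \<tau> p}" unfolding lepoll_def by blast
  obtain c :: "'v symbol \<times> 'v symbol \<Rightarrow> 'v" where c: "inj c"
    using symbol_pairs_lepoll unfolding lepoll_def by blast
  define \<rho> where "\<rho> = morley_language nm \<tau>"
  interpret relational_class \<rho> "morleyization nm ` C" c
    using language_morley [OF \<tau>] morley_language_relational c
    by unfold_locales (auto simp: \<rho>_def)
  obtain \<delta> where \<delta>: "cardinal \<delta>" "ULST_property CSen CSat \<delta>"
    using ULST [OF logic] unfolding is_ULST_def by blast
  have "\<exists>M\<in>C. \<not> univ M \<lesssim> elts \<delta>"
  proof (rule ccontr)
    assume "\<not> ?thesis"
    then have "small TYPE('v) C"
      using small_bounded_antichain [OF \<tau> nm C, of C \<delta>] antichain by blast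
    then show False using large by blast
  qed
  then obtain M where M: "M \<in> C" "elts \<delta> \<lesssim> univ M"
    using lepoll_linear by blast
  have sM: "is_struct M" "lang M = \<tau>" using C [OF M(1)] by (auto simp: is_structure_of_def)
  let ?M = "morleyization nm M"
  have M': "is_structure_of \<rho> ?M"
    using is_struct_morleyization [OF sM(1)] sM(2) by (simp add: is_structure_of_def \<rho>_def)
  obtain \<gamma> :: 'v where \<gamma>: "cardinal \<gamma>" "elts \<gamma> \<approx> univ M"
    using small_eqpoll_cardinal sM(1) unfolding is_struct_def by blast
  have \<delta>\<gamma>: "elts \<delta> \<subseteq> elts \<gamma>"
    using \<delta>(1) \<gamma>(1) lepoll_trans2 [OF M(2) eqpoll_sym [OF \<gamma>(2)]] by (rule cardinal_subset)
  obtain \<gamma>' :: 'v where \<gamma>': "cardinal \<gamma>'" "elts \<gamma> \<prec> elts \<gamma>'"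
    using larger_cardinal [OF small_elts] by blast
  have "\<exists>N. is_structure_of \<rho> N \<and> elts \<gamma>' \<lesssim> univ N \<and> CSat N (code id) \<and> substructure ?M N"
    using \<delta>(2) language_\<rho> code_id_sentence M' CSat_code_id_self [OF imageI [OF M(1)] M'] \<gamma>(1)
      eqpoll_sym [OF \<gamma>(2)] \<delta>\<gamma> \<gamma>'(1) lesspoll_cardinal_mem [OF \<gamma>(1) \<gamma>']
    unfolding ULST_property_def by simp
  then obtain N where N: "is_structure_of \<rho> N" "elts \<gamma>' \<lesssim> univ N" "CSat N (code id)"
    "substructure ?M N"
    by blast
  obtain M1 where M1: "M1 \<in> C" "rel_iso_along \<rho> id N (morleyization nm M1)"
    using CSat_code [OF _ renaming_id, of N] N(1,3) by (auto simp: is_structure_of_def)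
  then obtain h where h: "bij_betw h (univ N) (univ M1)"
    and h_rel: "\<And>s xs. s \<in> \<rho> \<Longrightarrow> xs \<in> tuples (univ N) (arity s) \<Longrightarrow>
      xs \<in> rel_of N s \<longleftrightarrow> map h xs \<in> rel_of (morleyization nm M1) s"
    unfolding rel_iso_along_def by auto
  have MN: "univ M \<subseteq> univ N" using N(4) by (simp add: substructure_def)
  \<comment> \<open>\<open>N\<close> extends the Morleyization of \<open>M\<close>, so restricting
    the isomorphism \<open>h\<close> to \<open>univ M\<close> respects all formula relations between
    \<open>M\<close> and \<open>M1\<close>.\<close>
  have "elementary_embedding h M M1"
  proof (rule morleyization_elementary_embedding)
    show "inj_on nm {p. wf_fm (lang M) p}" "lang M = lang M1"
      using nm sM(2) C [OF M1(1)] by (simp_all add: is_structure_of_def)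
    show "h ` univ M \<subseteq> univ M1" using h MN by (auto simp: bij_betw_def)
  next
    fix s xs assume s: "s \<in> morley_language nm (lang M)" and xs: "xs \<in> tuples (univ M) (arity s)"
    have s\<rho>: "s \<in> \<rho>" using s sM(2) by (simp add: \<rho>_def)
    have "rel_of ?M s = rel_of N s \<inter> tuples (univ M) (arity s)"
      using N(4) s s\<rho> relational by (simp add: substructure_def)
    moreover have "xs \<in> tuples (univ N) (arity s)" using xs MN by (auto simp: tuples_def)
    ultimately show "xs \<in> rel_of ?M s \<longleftrightarrow> map h xs \<in> rel_of (morleyization nm M1) s"
      using h_rel [OF s\<rho>] xs by simp
  qed
  \<comment> \<open>An elementary map from \<open>M\<close> to itself is no contradiction; the
    contradiction is one of size, since \<open>N\<close> is now equipollent to \<open>M\<close>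
    although it has size at least \<open>\<gamma>'\<close>.\<close>
  then have "M = M1" using antichain M(1) M1(1) by blast
  then have "univ N \<approx> univ M" using h unfolding eqpoll_def by blast
  then have "univ N \<approx> elts \<gamma>" using eqpoll_sym [OF \<gamma>(2)] eqpoll_trans by blast
  then have "elts \<gamma>' \<lesssim> elts \<gamma>" using N(2) lepoll_trans2 by blast
  then show False using \<gamma>'(2) lesspoll_trans2 lesspoll_not_refl by blast
qed

theorem theorem7p3:
  shows "Vopenka_Principle TYPE('v::zfc) \<longleftrightarrow>
    (\<forall>(Sen :: 'v language \<Rightarrow> 'v set) Sat. logic Sen Sat \<longrightarrow> (\<exists>\<delta>. is_ULST Sen Sat \<delta>))"
  using logic.Vopenka_imp_ULST ULST_imp_Vopenka by blast

end
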